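(* Let $h_1,h_2:\mathbb{R}\to\mathbb{R}$ be continuous piecewise linear functions with $h_i'(x)=\kappa_i^0$ for $x<0$ and $h_i'(x)=\kappa_i^1$ for $x>0$, $i=1,2$, where $(\kappa_1^0,\kappa_2^0)\in\mathcal{A}_3$ and $(\kappa_1^1,\kappa_2^1)\in\mathcal{A}_4$. Then the system $$u_1(x)=h_1(x)-u_1'u_2'-\tfrac{(u_1')^2}{2},\qquad u_2(x)=h_2(x)-u_1'u_2'-\tfrac{(u_2')^2}{2}$$ has no admissible solution $u=(u_1,u_2):\mathbb{R}\to\mathbb{R}^2$.
   Context: Sectors: for $k=1,\dots,8$, $\mathcal{A}_k=\{\rho(\cos\theta,\sin\theta)\in\mathbb{R}^2 : \rho>0,\ \theta\in\,](k-1)\pi/4,\ k\pi/4[\,\}$. Admissible solution: a function $u=(u_1,u_2):\mathbb{R}\to\mathbb{R}^2$ is an admissible solution of the displayed system if: (A1) $u$ is absolutely continuous (on bounded intervals) and its derivative $u'$ satisfies the system at a.e. $x\in\mathbb{R}$; (A2) there is a constant $C$ such that $|u(x)|\le C(1+|x|)$ for all $x\in\mathbb{R}$; (A3) at every $y\in\mathbb{R}$ the derivative $u'$ admits right and left limits $u'(y+)$, $u'(y-)$, and at points where $u'$ is discontinuous these limits satisfy at least one of the conditions $u_1'(y+)+u_2'(y+)\le 0$ or $u_1'(y-)+u_2'(y-)\ge 0$. *)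

theory Defs
  imports "HOL-Analysis.Analysis"
begin

(* Intended for k = 1, ..., 8. *)
definition sector :: "nat \<Rightarrow> (real \<times> real) set" where
  "sector k = {(\<rho> * cos \<theta>, \<rho> * sin \<theta>) | \<rho> \<theta>.
     \<rho> > 0 \<and> (real k - 1) * pi / 4 < \<theta> \<and> \<theta> < real k * pi / 4}"

(* Absolute continuity of functions, in the epsilon-delta sense. The constant
   absolutely_continuous of HOL-Analysis is the unrelated notion for measures.
   A pair (s, t) in P stands for the interval with end points s < t. *)
definition abs_continuous_on :: "real set \<Rightarrow> (real \<Rightarrow> 'a::real_normed_vector) \<Rightarrow> bool" where
  "abs_continuous_on S f \<longleftrightarrow>
     (\<forall>\<epsilon>>0. \<exists>\<delta>>0. \<forall>P :: (real \<times> real) set.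
        finite P \<and> (\<forall>(s, t)\<in>P. s < t \<and> {s..t} \<subseteq> S) \<and>
        disjoint_family_on (\<lambda>(s, t). {s<..<t}) P \<and> (\<Sum>(s, t)\<in>P. t - s) < \<delta>
        \<longrightarrow> (\<Sum>(s, t)\<in>P. norm (f t - f s)) < \<epsilon>)"

definition diff_points :: "(real \<Rightarrow> real \<times> real) \<Rightarrow> real set" where
  "diff_points u = {x. u differentiable (at x)}"

(* Only meaningful at points of diff_points u. *)
definition du :: "(real \<Rightarrow> real \<times> real) \<Rightarrow> real \<Rightarrow> real \<times> real" where
  "du u x = vector_derivative u (at x)"

definition satisfies_system_at ::
  "(real \<Rightarrow> real) \<Rightarrow> (real \<Rightarrow> real) \<Rightarrow> (real \<Rightarrow> real \<times> real) \<Rightarrow> real \<Rightarrow> bool" where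
  "satisfies_system_at h1 h2 u x \<longleftrightarrow>
     x \<in> diff_points u \<and>
     fst (u x) = h1 x - fst (du u x) * snd (du u x) - (fst (du u x))\<^sup>2 / 2 \<and>
     snd (u x) = h2 x - fst (du u x) * snd (du u x) - (snd (du u x))\<^sup>2 / 2"

(* u' is regarded as a function on diff_points u: one-sided limits and continuity
   of u' are taken along this set. It has full measure for the functions
   considered here, so none of these limits is vacuous. *)
definition du_right_limit :: "(real \<Rightarrow> real \<times> real) \<Rightarrow> real \<Rightarrow> real \<times> real \<Rightarrow> bool" where
  "du_right_limit u y p \<longleftrightarrow> (du u \<longlongrightarrow> p) (at y within (diff_points u \<inter> {y<..}))"

definition du_left_limit :: "(real \<Rightarrow> real \<times> real) \<Rightarrow> real \<Rightarrow> real \<times> real \<Rightarrow> bool" where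
  "du_left_limit u y p \<longleftrightarrow> (du u \<longlongrightarrow> p) (at y within (diff_points u \<inter> {..<y}))"

definition du_continuous_at :: "(real \<Rightarrow> real \<times> real) \<Rightarrow> real \<Rightarrow> bool" where
  "du_continuous_at u y \<longleftrightarrow>
     y \<in> diff_points u \<and> continuous (at y within diff_points u) (du u)"

definition admissible_solution ::
  "(real \<Rightarrow> real) \<Rightarrow> (real \<Rightarrow> real) \<Rightarrow> (real \<Rightarrow> real \<times> real) \<Rightarrow> bool" where
  "admissible_solution h1 h2 u \<longleftrightarrow>
     (\<forall>a b. abs_continuous_on {a..b} u) \<and>
     (AE x in lebesgue. satisfies_system_at h1 h2 u x) \<and>
     (\<exists>C. \<forall>x. norm (u x) \<le> C * (1 + \<bar>x\<bar>)) \<and>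
     (\<forall>y. \<exists>pr pl. du_right_limit u y pr \<and> du_left_limit u y pl \<and>
        (\<not> du_continuous_at u y \<longrightarrow>
           fst pr + snd pr \<le> 0 \<or> fst pl + snd pl \<ge> 0))"

end

theory Submission
  imports Defs
begin

text \<open>
  The quadratic map \<open>(p, q) \<mapsto> (p * q + p\<^sup>2 / 2, p * q + q\<^sup>2 / 2)\<close> is complex squaring in the coordinate
  \<open>z = sqrt 3 * (p + q) + \<i> * (p - q)\<close>. So \<open>z\<^sup>2\<close> is a continuous function of \<open>h - u\<close>, \<open>u'\<close> can only jump from \<open>z\<close> to
  \<open>- z\<close>, and admissibility lets \<open>Re z\<close> only jump downwards. On a half line \<open>z\<close> follows a planar flow.

  On \<open>x > 0\<close> this forces \<open>Im z\<^sup>2 > 0\<close> at \<open>x = 0\<close>. Otherwise \<open>z\<close> never enters the open first quadrant; in the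
  second quadrant it is trapped and \<open>z\<^sup>2\<close> grows superlinearly; so \<open>z\<close> stays without jumps in the lower half plane.
  There a Lyapunov function pushes it outwards around the repelling equilibrium until it escapes
  downwards or to the left, and again \<open>z\<^sup>2\<close> grows superlinearly, against the linear growth of \<open>u\<close>. By reflection,
  the half line \<open>x < 0\<close> forces \<open>Im z\<^sup>2 < 0\<close> at \<open>x = 0\<close>.
\<close>

section \<open>One-sided derivatives and growth\<close>

text \<open>A half line alone gives no contradiction: the constant \<open>u' = h'\<close>, the
  equilibrium, meets every requirement there. The conflict lies in the sign of the continuous
  function \<open>A = s * d\<close> at 0. At the equilibrium \<open>A\<close> equals
  \<open>\<sigma> * \<delta> > 0\<close>, so starting with \<open>A 0 \<le> 0\<close> excludes the
  stationary solution and must be shown to keep the flow away from the equilibrium for good. Local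
  repulsion is not enough for this. For \<sigma> = 0 the equilibrium is a centre surrounded by
  closed orbits, so for \<sigma> < 0 a function is needed that is monotone along whole orbits in the
  lower half plane; it is a perturbation of the first integral of the case \<sigma> = 0. The
  function \<open>L\<close>, monotone only for \<open>s < - \<sigma>\<close>, has another task: it
  bounds the distance to the equilibrium from below, which makes the growth of
  \<open>J + \<epsilon> * \<psi>\<close> uniform. Being a square root of a continuous function, z
  may jump and may fail to be differentiable at its zeros. Hence most estimates concern
  \<open>A\<close> and \<open>B\<close> through right derivatives, and derivatives of
  \<open>s\<close> and \<open>d\<close> are used only where \<open>d\<close> is nonzero.\<close>

lemma last_time_below:
  fixes f :: "real \<Rightarrow> real"
  assumes "a \<le> b" "continuous_on {a..b} f" "f a \<le> m"
  obtains c where "a \<le> c" "c \<le> b" "f c \<le> m" "\<And>y. c < y \<Longrightarrow> y \<le> b \<Longrightarrow> m < f y"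
proof -
  define S where "S = {y \<in> {a..b}. f y \<le> m}"
  have "closed S" unfolding S_def
    by (intro continuous_on_closed_Collect_le continuous_intros assms closed_atLeastAtMost)
  moreover have "bounded S"
    by (rule bounded_subset[OF bounded_closed_interval, of _ a b]) (auto simp: S_def)
  ultimately have "compact S" by (simp add: compact_eq_bounded_closed)
  moreover have "a \<in> S" using assms by (simp add: S_def)
  ultimately obtain c where c: "c \<in> S" "\<And>y. y \<in> S \<Longrightarrow> y \<le> c"
    using compact_attains_sup[of S] by auto
  show ?thesis
  proof (rule that)
    show "a \<le> c" "c \<le> b" "f c \<le> m" using c(1) by (auto simp: S_def)
    fix y assume y: "c < y" "y \<le> b"
    then have "y \<notin> S" using c(2) by fastforce
    then show "m < f y" using y \<open>a \<le> c\<close> by (auto simp: S_def)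
  qed
qed

lemma eventually_at_right_between:
  fixes c b :: real
  assumes "c < b" "\<forall>\<^sub>F y in at_right c. P y"
  obtains y where "c < y" "y < b" "P y"
proof -
  have "\<forall>\<^sub>F y in at_right c. c < y \<and> y < b"
    using assms(1) by (auto simp: eventually_at_right_field)
  with assms(2) have "\<forall>\<^sub>F y in at_right c. P y \<and> c < y \<and> y < b" by (rule eventually_conj)
  then show ?thesis using that eventually_happens trivial_limit_at_right_real
    by (metis (no_types, lifting))
qed

text \<open>The local hypothesis is an inequality with arbitrarily small slope error instead of a
  derivative, because it is also applied to a Lyapunov function at times where that function need
  not be differentiable.\<close>

lemma local_right_mono:
  fixes f :: "real \<Rightarrow> real"
  assumes ab: "a \<le> b" and cont: "continuous_on {a..b} f"
    and loc: "\<And>x e. a \<le> x \<Longrightarrow> x < b \<Longrightarrow> 0 < e \<Longrightarrow> \<forall>\<^sub>F y in at_right x. f y \<ge> f x - e * (y - x)"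
  shows "f a \<le> f b"
proof (rule field_le_epsilon)
  fix \<epsilon> :: real assume \<epsilon>: "\<epsilon> > 0"
  \<comment> \<open>The added slope then costs at most \<epsilon> over the interval; the summand 1
    covers \<open>a = b\<close>.\<close>
  define e where "e = \<epsilon> / (b - a + 1)"
  have e: "e > 0" using ab \<epsilon> by (simp add: e_def)
  define g where "g x = f x + e * (x - a)" for x
  have cg: "continuous_on {a..b} g" unfolding g_def by (intro continuous_intros cont)
  have "continuous_on {a..b} (\<lambda>x. - g x)" by (intro continuous_intros cg)
  then obtain c where c: "a \<le> c" "c \<le> b" "- g c \<le> - g a" "\<And>y. c < y \<Longrightarrow> y \<le> b \<Longrightarrow> - g a < - g y"
    using last_time_below[OF ab, of "\<lambda>x. - g x" "- g a"] by auto
  have "c = b"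
  proof (rule ccontr)
    assume "c \<noteq> b"
    then have cb: "a \<le> c" "c < b" using c by auto
    obtain y where y: "c < y" "y < b" "f y \<ge> f c - e * (y - c)"
      using eventually_at_right_between[OF cb(2) loc[OF cb e]] .
    then have "g y \<ge> g c" by (simp add: g_def algebra_simps)
    then show False using c(3) c(4)[of y] y by simp
  qed
  then have "g a \<le> g b" using c(3) by simp
  moreover have "e * (b - a) \<le> \<epsilon>" using ab \<epsilon> by (simp add: e_def field_simps)
  ultimately show "f a \<le> f b + \<epsilon>" by (simp add: g_def)
qed

lemma right_deriv_eventually_ge:
  fixes f :: "real \<Rightarrow> real"
  assumes "(f has_real_derivative D) (at_right x)" "m < D"
  shows "\<forall>\<^sub>F y in at_right x. f y > f x + m * (y - x)"
proof -
  have "((\<lambda>y. (f y - f x) / (y - x)) \<longlongrightarrow> D) (at_right x)"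
    using assms(1) by (simp add: has_field_derivative_iff)
  then have "\<forall>\<^sub>F y in at_right x. (f y - f x) / (y - x) > m" using assms(2) by (rule order_tendstoD)
  moreover have "\<forall>\<^sub>F y in at_right x. y > x" by (rule eventually_at_right_less)
  ultimately show ?thesis by eventually_elim (simp add: field_simps)
qed

text \<open>A mean value inequality from right derivatives alone, since \<open>A\<close> and
  \<open>B\<close> have kinks wherever \<open>s\<close> and \<open>d\<close> jump.\<close>

lemma right_deriv_lower_bound:
  fixes f :: "real \<Rightarrow> real"
  assumes ab: "a \<le> b" and cont: "continuous_on {a..b} f"
    and der: "\<And>x. a \<le> x \<Longrightarrow> x < b \<Longrightarrow> \<exists>D\<ge>m. (f has_real_derivative D) (at_right x)"
  shows "f b \<ge> f a + m * (b - a)"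
proof -
  have "f a - m * a \<le> f b - m * b"
  proof (rule local_right_mono[OF ab])
    show "continuous_on {a..b} (\<lambda>x. f x - m * x)" by (intro continuous_intros cont)
    fix x e :: real assume x: "a \<le> x" "x < b" "0 < e"
    obtain D where D: "D \<ge> m" "(f has_real_derivative D) (at_right x)" using der x by blast
    have "\<forall>\<^sub>F y in at_right x. f y > f x + (m - e) * (y - x)"
      by (rule right_deriv_eventually_ge[OF D(2)]) (use D x in simp)
    then show "\<forall>\<^sub>F y in at_right x. f y - m * y \<ge> f x - m * x - e * (y - x)"
      by eventually_elim (simp add: algebra_simps)
  qed
  then show ?thesis by (simp add: algebra_simps)
qed

text \<open>After the last time at or below the level the function would have to stay above it; a
  negative right derivative on the level, or continuity below it, prevents this. So the sign is
  needed on the level only.\<close>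

lemma barrier:
  fixes f :: "real \<Rightarrow> real"
  assumes cont: "continuous_on {a..} f" and init: "f a \<le> m"
    and der: "\<And>x. a \<le> x \<Longrightarrow> f x = m \<Longrightarrow> \<exists>D<0. (f has_real_derivative D) (at_right x)"
    and x: "a \<le> x"
  shows "f x \<le> m"
proof (rule ccontr)
  assume "\<not> f x \<le> m"
  have "continuous_on {a..x} f" by (rule continuous_on_subset[OF cont]) auto
  then obtain c where c: "a \<le> c" "c \<le> x" "f c \<le> m" "\<And>y. c < y \<Longrightarrow> y \<le> x \<Longrightarrow> m < f y"
    using last_time_below[where f=f, OF x _ init] by blast
  then have cb: "a \<le> c" "c < x" "f c \<le> m" using \<open>\<not> f x \<le> m\<close> by (auto simp: less_le)
  have "\<forall>\<^sub>F y in at_right c. f y \<le> m"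
  proof (cases "f c = m")
    case True
    then obtain D where "D < 0" "(f has_real_derivative D) (at_right c)" using der cb by blast
    then have "\<forall>\<^sub>F y in at_right c. - f y > - f c + 0 * (y - c)"
      by (intro right_deriv_eventually_ge[of _ "- D"] derivative_intros) auto
    then show ?thesis by eventually_elim (use True in simp)
  next
    case False
    have "(f \<longlongrightarrow> f c) (at c within {a..})" using cont cb by (auto simp: continuous_on_def)
    then have "(f \<longlongrightarrow> f c) (at_right c)"
      by (rule tendsto_within_subset) (use cb in auto)
    then have "\<forall>\<^sub>F y in at_right c. f y < m" using False cb by (intro order_tendstoD) auto
    then show ?thesis by eventually_elim simp
  qed
  then obtain y where "c < y" "y < x" "f y \<le> m"
    using eventually_at_right_between[OF cb(2)] by blast
  then show False using c(4)[of y] by simp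
qed

text \<open>\<open>G\<close> grows at least linearly, so \<open>sqrt (G x)\<close> tends to infinity
  and the slope of \<open>S\<close> eventually exceeds \<open>C + 1\<close>, which beats the bound
  of slope \<open>C\<close>. Taking \<open>S\<close> different from \<open>G\<close> allows adding a
  second quantity whose derivative supplies the missing size.\<close>

lemma superlinear_growth_contradiction:
  fixes G S :: "real \<Rightarrow> real"
  assumes cG: "continuous_on {a..} G" and cS: "continuous_on {a..} S"
    and G: "\<And>x. a \<le> x \<Longrightarrow> \<exists>D\<ge>\<epsilon>. (G has_real_derivative D) (at_right x)"
    and S: "\<And>x. a \<le> x \<Longrightarrow> 0 < G x \<Longrightarrow> \<exists>D\<ge>k * sqrt (G x) - C'. (S has_real_derivative D) (at_right x)"
    and bound: "\<And>x. a \<le> x \<Longrightarrow> S x \<le> C * (1 + x)"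
    and pos: "\<epsilon> > 0" "k > 0"
  shows False
proof -
  \<comment> \<open>Chosen so that \<open>k * R - C' \<ge> C + 1\<close>.\<close>
  define R where "R = (\<bar>C\<bar> + 1 + \<bar>C'\<bar>) / k"
  have R: "R > 0" using pos by (simp add: R_def add_pos_nonneg)
  define x2 where "x2 = a + (\<bar>G a\<bar> + R\<^sup>2) / \<epsilon>"
  have x2: "a \<le> x2" using pos by (simp add: x2_def)
  have Gbig: "G x \<ge> R\<^sup>2" if x: "x \<ge> x2" for x
  proof -
    have "G x \<ge> G a + \<epsilon> * (x - a)"
      by (rule right_deriv_lower_bound) (use x x2 G in \<open>auto intro: continuous_on_subset[OF cG]\<close>)
    moreover have "\<epsilon> * (x - a) \<ge> \<bar>G a\<bar> + R\<^sup>2"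
      using x pos by (simp add: x2_def field_simps)
    ultimately show ?thesis by linarith
  qed
  have Sbig: "S x \<ge> S x2 + (C + 1) * (x - x2)" if x: "x \<ge> x2" for x
  proof (rule right_deriv_lower_bound[OF x])
    show "continuous_on {x2..x} S" by (rule continuous_on_subset[OF cS]) (use x2 in auto)
    fix y assume y: "x2 \<le> y" "y < x"
    have "sqrt (G y) \<ge> R" using Gbig[OF y(1)] R by (simp add: real_le_rsqrt)
    then have "k * sqrt (G y) \<ge> k * R" using pos by simp
    also have "k * R = \<bar>C\<bar> + 1 + \<bar>C'\<bar>" using pos by (simp add: R_def)
    finally have "k * sqrt (G y) - C' \<ge> C + 1" by linarith
    moreover have "0 < G y" using Gbig[OF y(1)] R by (meson less_le_trans zero_less_power)
    ultimately show "\<exists>D\<ge>C + 1. (S has_real_derivative D) (at_right y)"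
      using S[of y] x2 y by (meson order_trans)
  qed
  \<comment> \<open>The second entry solves
    \<open>S x2 + (C + 1) * (x - x2) \<ge> C * (1 + x) + 1\<close> for \<open>x\<close>.\<close>
  define x where "x = max x2 (C + (C + 1) * x2 - S x2 + 1)"
  have "S x \<le> C * (1 + x)" using bound x2 by (simp add: x_def)
  moreover have "S x \<ge> S x2 + (C + 1) * (x - x2)" by (rule Sbig) (simp add: x_def)
  moreover have "x \<ge> C + (C + 1) * x2 - S x2 + 1" by (simp add: x_def)
  ultimately show False by (simp add: algebra_simps)
qed

section \<open>The flow on a half line\<close>

text \<open>
  For \<open>u' = (p, q)\<close> put \<open>s = p + q\<close>, \<open>d = p - q\<close>; \<open>sl\<close> and \<open>dl\<close> are the left limits of the right-continuous
  functions \<open>s\<close> and \<open>d\<close>. With \<open>z = sqrt 3 * s + \<i> * d\<close> one has \<open>z\<^sup>2 = B + 2 * sqrt 3 * \<i> * A\<close>.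
  The parameters \<open>\<sigma>\<close>, \<open>\<delta>\<close> are the values of \<open>s\<close>, \<open>d\<close> at the equilibrium \<open>u' = h'\<close>.
\<close>
locale half_line_flow =
  fixes \<sigma> \<delta> :: real and s d sl dl A B :: "real \<Rightarrow> real" and C :: real
  assumes sigma: "\<sigma> < 0" and delta: "\<delta> < 0"
    and A_cont: "continuous_on {0..} A" and B_cont: "continuous_on {0..} B"
    and A_eq: "\<And>x. 0 \<le> x \<Longrightarrow> A x = s x * d x"
    and B_eq: "\<And>x. 0 \<le> x \<Longrightarrow> B x = 3 * (s x)\<^sup>2 - (d x)\<^sup>2"
    and A_right: "\<And>x. 0 \<le> x \<Longrightarrow> (A has_real_derivative 2 * (\<delta> - d x)) (at_right x)"
    and B_right: "\<And>x. 0 \<le> x \<Longrightarrow> (B has_real_derivative 4 * (\<sigma> - s x)) (at_right x)"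
    and A_left: "\<And>x. 0 < x \<Longrightarrow> (A has_real_derivative 2 * (\<delta> - dl x)) (at_left x)"
    and B_left: "\<And>x. 0 < x \<Longrightarrow> (B has_real_derivative 4 * (\<sigma> - sl x)) (at_left x)"
    and s_right: "\<And>x. 0 \<le> x \<Longrightarrow> (s \<longlongrightarrow> s x) (at_right x)"
    and d_right: "\<And>x. 0 \<le> x \<Longrightarrow> (d \<longlongrightarrow> d x) (at_right x)"
    and s_left: "\<And>x. 0 < x \<Longrightarrow> (s \<longlongrightarrow> sl x) (at_left x)"
    and d_left: "\<And>x. 0 < x \<Longrightarrow> (d \<longlongrightarrow> dl x) (at_left x)"
    and jump: "\<And>x. 0 < x \<Longrightarrow> sl x = s x \<and> dl x = d x \<or> sl x = - s x \<and> dl x = - d x \<and> s x \<le> 0"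
    and A_growth: "\<And>x. 0 \<le> x \<Longrightarrow> \<bar>A x\<bar> \<le> C * (1 + x)"
    and B_growth: "\<And>x. 0 \<le> x \<Longrightarrow> \<bar>B x\<bar> \<le> C * (1 + x)"
begin

section \<open>Trapping in the upper half plane\<close>

lemma cont_A: "0 \<le> a \<Longrightarrow> continuous_on {a..b} A" "0 \<le> a \<Longrightarrow> continuous_on {a..} A"
  by (auto intro!: continuous_on_subset[OF A_cont])

lemma cont_B: "0 \<le> a \<Longrightarrow> continuous_on {a..b} B" "0 \<le> a \<Longrightarrow> continuous_on {a..} B"
  by (auto intro!: continuous_on_subset[OF B_cont])

lemma uminus_A_right:
  "0 \<le> x \<Longrightarrow> ((\<lambda>x. - A x) has_real_derivative 2 * (d x - \<delta>)) (at_right x)"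
  using DERIV_minus[OF A_right] by (simp add: algebra_simps)

text \<open>Jumps lead only to \<open>s \<le> 0\<close>, and a continuous change of sign would need
  a zero of \<open>s\<close>, hence of \<open>A\<close>. At the supremum of the times with
  \<open>s < 0\<close>, right continuity excludes a negative value and the left limit excludes a
  positive one.\<close>

lemma s_neg_persists:
  assumes y: "0 \<le> y" "y \<le> x" "s y < 0" and nz: "\<And>w. y \<le> w \<Longrightarrow> w \<le> x \<Longrightarrow> A w \<noteq> 0"
  shows "s x < 0"
proof (rule ccontr)
  assume "\<not> s x < 0"
  define c where "c = Sup {w \<in> {y..x}. s w < 0}"
  have ne: "{w \<in> {y..x}. s w < 0} \<noteq> {}" using y by force
  have bdd: "bdd_above {w \<in> {y..x}. s w < 0}" by (rule bdd_aboveI[of _ x]) auto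
  have cy: "y \<le> c" unfolding c_def by (rule cSup_upper[OF _ bdd]) (use y in auto)
  have cx: "c \<le> x" unfolding c_def by (rule cSup_least[OF ne]) auto
  have above: "\<not> s w < 0" if "c < w" "w \<le> x" for w
    using cSup_upper[OF _ bdd, of w] that cy by (auto simp: c_def)
  have c0: "0 \<le> c" using cy y by simp
  have snz: "s c \<noteq> 0" using nz[OF cy cx] A_eq[OF c0] by auto
  show False
  proof (cases "s c < 0")
    case True
    then have "c < x" using cx \<open>\<not> s x < 0\<close> by (auto simp: less_le)
    have "\<forall>\<^sub>F w in at_right c. s w < 0" using s_right[OF c0] True by (rule order_tendstoD)
    then obtain w where "c < w" "w < x" "s w < 0"
      using eventually_at_right_between[OF \<open>c < x\<close>] by blast
    then show False using above[of w] by simp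
  next
    case False
    then have pos: "s c > 0" using snz by simp
    then have "y < c" using cy y by (auto simp: less_le)
    then have "sl c = s c" using jump[of c] pos y by auto
    then have "\<forall>\<^sub>F w in at_left c. s w > 0"
      using s_left[of c] pos \<open>y < c\<close> y by (intro order_tendstoD) auto
    then obtain r where r: "r < c" "\<And>w. r < w \<Longrightarrow> w < c \<Longrightarrow> s w > 0"
      by (auto simp: eventually_at_left_field)
    have "max r y < Sup {w \<in> {y..x}. s w < 0}" using r \<open>y < c\<close> by (simp add: c_def)
    then obtain w where w: "w \<in> {w \<in> {y..x}. s w < 0}" "max r y < w"
      using less_cSup_iff[OF ne bdd] by blast
    have "w \<le> c" unfolding c_def by (rule cSup_upper[OF w(1) bdd])
    then show False using r(2)[of w] w False by (cases "w = c") auto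
  qed
qed

text \<open>Since the last time with \<open>A \<le> 0\<close>, \<open>s\<close> cannot have been
  negative, as it would have stayed so; thus \<open>d > 0\<close> throughout. But \<open>A\<close>
  decreases there, its right derivative being \<open>2 * (\<delta> - d)\<close>, and cannot have
  become positive.\<close>

lemma no_first_quadrant:
  assumes A0: "A 0 \<le> 0" and x: "0 \<le> x"
  shows "\<not> (s x > 0 \<and> d x > 0)"
proof
  assume pos: "s x > 0 \<and> d x > 0"
  then have Ax: "A x > 0" using A_eq[OF x] by simp
  obtain c where c: "0 \<le> c" "c \<le> x" "A c \<le> 0" "\<And>y. c < y \<Longrightarrow> y \<le> x \<Longrightarrow> 0 < A y"
    using last_time_below[where f=A, OF x cont_A(1) A0] by auto
  have cx: "c < x" using c Ax by (auto simp: less_le)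
  have dpos: "d y > 0" if y: "c < y" "y \<le> x" for y
  proof -
    have "A w \<noteq> 0" if "y \<le> w" "w \<le> x" for w using c(4)[of w] y that by simp
    then have "\<not> s y < 0" using s_neg_persists[of y x] y c(1) pos by auto
    then show ?thesis using c(4)[OF y] A_eq[of y] y c(1) by (simp add: zero_less_mult_iff)
  qed
  have "d c \<ge> 0"
  proof (rule tendsto_lowerbound[OF d_right[OF c(1)]])
    show "\<forall>\<^sub>F y in at_right c. 0 \<le> d y"
      using dpos cx by (auto simp: eventually_at_right_field intro!: exI[of _ x] less_imp_le)
  qed simp
  have "(\<lambda>y. - A y) x \<ge> (\<lambda>y. - A y) c + 0 * (x - c)"
  proof (rule right_deriv_lower_bound)
    show "continuous_on {c..x} (\<lambda>y. - A y)" by (intro continuous_intros cont_A c)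
    fix y assume y: "c \<le> y" "y < x"
    then have "d y \<ge> 0" using \<open>d c \<ge> 0\<close> dpos[of y] by (cases "y = c") auto
    then show "\<exists>D\<ge>0. ((\<lambda>y. - A y) has_real_derivative D) (at_right y)"
      using uminus_A_right[of y] y c(1) delta by (intro exI[of _ "2 * (d y - \<delta>)"]) auto
  qed (use cx in auto)
  then show False using Ax c(3) by simp
qed

text \<open>As long as \<open>A < 0\<close>, the sign of \<open>s\<close> persists, so
  \<open>d > 0\<close> and \<open>A\<close> decreases further. Hence there is no first time with
  \<open>A \<ge> 0\<close>.\<close>

lemma second_quadrant_persists:
  assumes x1: "0 \<le> x1" "s x1 < 0" "A x1 < 0" and x: "x1 \<le> x"
  shows "A x < 0 \<and> s x < 0"
proof -
  have A_neg: "A x < 0" if x: "x1 \<le> x" for x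
  proof (rule ccontr)
    assume Ax: "\<not> A x < 0"
    define T where "T = {y \<in> {x1..x}. 0 \<le> A y}"
    have "closed T" unfolding T_def
      by (intro continuous_on_closed_Collect_le continuous_intros cont_A x1 closed_atLeastAtMost)
    moreover have "bounded T"
      by (rule bounded_subset[OF bounded_closed_interval, of _ x1 x]) (auto simp: T_def)
    ultimately have "compact T" by (simp add: compact_eq_bounded_closed)
    moreover have "x \<in> T" using Ax x by (simp add: T_def)
    ultimately obtain c where c: "c \<in> T" "\<And>y. y \<in> T \<Longrightarrow> c \<le> y"
      using compact_attains_inf[of T] by auto
    have neg: "A y < 0" if "x1 \<le> y" "y < c" for y
      using c(2)[of y] c(1) that by (force simp: T_def)
    have "(\<lambda>y. - A y) c \<ge> (\<lambda>y. - A y) x1 + 0 * (c - x1)"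
    proof (rule right_deriv_lower_bound)
      show "x1 \<le> c" using c by (simp add: T_def)
      show "continuous_on {x1..c} (\<lambda>y. - A y)" by (intro continuous_intros cont_A x1)
      fix y assume y: "x1 \<le> y" "y < c"
      have "s y < 0" using s_neg_persists[of x1 y] x1 y neg by fastforce
      then have "d y > 0" using neg[OF y] A_eq[of y] y x1 by (simp add: mult_less_0_iff)
      then show "\<exists>D\<ge>0. ((\<lambda>y. - A y) has_real_derivative D) (at_right y)"
        using uminus_A_right[of y] y x1 delta by (intro exI[of _ "2 * (d y - \<delta>)"]) auto
    qed
    then show False using c(1) x1(3) by (simp add: T_def)
  qed
  then have "s x < 0" using s_neg_persists[of x1 x] x1 x by force
  then show ?thesis using A_neg x by simp
qed

lemma sqrt_mult_le_half_sum: "sqrt (\<bar>p * q\<bar>) \<le> (\<bar>p\<bar> + \<bar>q\<bar>) / 2" for p q :: real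
  using arith_geo_mean_sqrt[of "\<bar>p\<bar>" "\<bar>q\<bar>"] by (simp add: abs_mult)

text \<open>Here \<open>A\<close> falls with slope at most \<open>2 * \<delta>\<close>, while up to
  a constant the slope of \<open>B - A\<close> is
  \<open>4 * \<bar>s\<bar> + 2 * \<bar>d\<bar>\<close>, which dominates
  \<open>4 * sqrt (- A)\<close> by the inequality of arithmetic and geometric means.\<close>

lemma no_second_quadrant:
  assumes x1: "0 \<le> x1" "s x1 < 0" "A x1 < 0"
  shows False
proof (rule superlinear_growth_contradiction[where a=x1 and G="\<lambda>x. - A x" and S="\<lambda>x. B x - A x"
      and k=4 and \<epsilon>="- 2 * \<delta>" and C'="\<bar>4 * \<sigma> - 2 * \<delta>\<bar>" and C="2 * C"])
  show "continuous_on {x1..} (\<lambda>x. - A x)" "continuous_on {x1..} (\<lambda>x. B x - A x)"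
    by (intro continuous_intros cont_A cont_B x1)+
  fix x assume x: "x1 \<le> x"
  then have x0: "0 \<le> x" using x1 by simp
  have neg: "s x < 0" "A x < 0" using second_quadrant_persists[OF x1 x] by auto
  then have dx: "d x > 0" using A_eq[OF x0] by (simp add: mult_less_0_iff)
  show "\<exists>D\<ge>- 2 * \<delta>. ((\<lambda>x. - A x) has_real_derivative D) (at_right x)"
    using dx uminus_A_right[OF x0] by (intro exI[of _ "2 * (d x - \<delta>)"]) auto
  have "sqrt (- A x) \<le> (\<bar>s x\<bar> + \<bar>d x\<bar>) / 2"
    using sqrt_mult_le_half_sum[of "s x" "d x"] A_eq[OF x0] neg by (simp add: abs_if)
  then have "4 * sqrt (- A x) - \<bar>4 * \<sigma> - 2 * \<delta>\<bar> \<le> 4 * (\<sigma> - s x) - 2 * (\<delta> - d x)"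
    using neg dx by (simp add: abs_if split: if_splits)
  then show "\<exists>D\<ge>4 * sqrt (- A x) - \<bar>4 * \<sigma> - 2 * \<delta>\<bar>. ((\<lambda>x. B x - A x) has_real_derivative D) (at_right x)"
    using DERIV_diff[OF B_right[OF x0] A_right[OF x0]] by blast
  show "B x - A x \<le> 2 * C * (1 + x)" using A_growth[OF x0] B_growth[OF x0] by (simp add: abs_le_iff)
qed (use delta in auto)

lemma A_neg_right_after:
  assumes x: "0 \<le> x" and A: "A x = 0" and d: "d x \<ge> 0"
  shows "\<forall>\<^sub>F y in at_right x. A y < 0"
proof -
  have "\<forall>\<^sub>F y in at_right x. - A y > - A x + 0 * (y - x)"
    by (rule right_deriv_eventually_ge[OF uminus_A_right[OF x]]) (use d delta in auto)
  then show ?thesis by eventually_elim (use A in simp)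
qed

lemma no_second_quadrant_near:
  assumes x: "0 \<le> x" and A: "A x = 0" and d: "d x \<ge> 0" and s: "\<forall>\<^sub>F y in at_right x. s y < 0 \<or> d y > 0"
  shows False
proof -
  have "\<forall>\<^sub>F y in at_right x. A y < 0 \<and> (s y < 0 \<or> d y > 0)"
    by (intro eventually_conj A_neg_right_after assms)
  then obtain y where y: "x < y" "A y < 0" "s y < 0 \<or> d y > 0"
    using eventually_at_right_between[of x "x + 1"] by auto
  then have "s y < 0" using A_eq[of y] x by (auto simp: mult_less_0_iff)
  then show False using no_second_quadrant[of y] y x by simp
qed

text \<open>On a boundary ray of the open quadrants already excluded, a nearby time lies inside such
  a quadrant: a later one on the rays \<open>s = 0\<close> and \<open>s < 0\<close>, because
  \<open>A\<close> becomes negative. On the ray \<open>s > 0\<close>, \<open>d = 0\<close> only an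
  earlier time helps, which is why \<open>x\<close> must be positive.\<close>

lemma lower_half_plane:
  assumes A0: "A 0 \<le> 0" and x: "0 < x"
  shows "d x < 0 \<or> s x = 0 \<and> d x = 0"
proof (rule ccontr)
  have x0: "0 \<le> x" using x by simp
  assume "\<not> ?thesis"
  then consider "s x > 0" "d x > 0" | "s x < 0" "d x > 0" | "s x = 0" "d x > 0"
    | "s x < 0" "d x = 0" | "s x > 0" "d x = 0" by linarith
  then show False
  proof cases
    case 1 then show False using no_first_quadrant[OF A0 x0] by simp
  next
    case 2 then show False using no_second_quadrant[OF x0] A_eq[OF x0] by (simp add: mult_less_0_iff)
  next
    case 3
    then have "\<forall>\<^sub>F y in at_right x. d y > 0" using d_right[OF x0] by (auto intro: order_tendstoD)
    then have "\<forall>\<^sub>F y in at_right x. s y < 0 \<or> d y > 0" by eventually_elim simp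
    then show False using no_second_quadrant_near[OF x0] 3 A_eq[OF x0] by simp
  next
    case 4
    then have "\<forall>\<^sub>F y in at_right x. s y < 0" using s_right[OF x0] by (auto intro: order_tendstoD)
    then have "\<forall>\<^sub>F y in at_right x. s y < 0 \<or> d y > 0" by eventually_elim simp
    then show False using no_second_quadrant_near[OF x0] 4 A_eq[OF x0] by simp
  next
    case 5
    \<comment> \<open>A jump would end with \<open>s x \<le> 0\<close>, so this point is reached
      continuously.\<close>
    then have l: "sl x = s x" "dl x = 0" using jump[OF x] by auto
    have "\<forall>\<^sub>F y in at_left x. s y > 0" using s_left[OF x] l 5 by (auto intro: order_tendstoD)
    moreover have "\<forall>\<^sub>F y in at_left x. A y > 0"
    proof -
      have "((\<lambda>y. (A y - A x) / (y - x)) \<longlongrightarrow> 2 * (\<delta> - dl x)) (at_left x)"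
        using A_left[OF x] by (simp add: has_field_derivative_iff)
      then have "\<forall>\<^sub>F y in at_left x. (A y - A x) / (y - x) < 0"
        by (rule order_tendstoD) (use l delta in simp)
      moreover have "\<forall>\<^sub>F y in at_left x. y < x" by (auto simp: eventually_at_left_field intro: exI[of _ "x - 1"])
      ultimately show ?thesis
        by eventually_elim (use 5 A_eq[OF x0] in \<open>auto simp: divide_less_0_iff\<close>)
    qed
    moreover have "\<forall>\<^sub>F y in at_left x. y > 0" using x by (auto simp: eventually_at_left_field)
    ultimately have "\<forall>\<^sub>F y in at_left x. s y > 0 \<and> A y > 0 \<and> y > 0" by eventually_elim simp
    then obtain y where "s y > 0" "A y > 0" "y > 0"
      using eventually_happens trivial_limit_at_left_real by (metis (no_types, lifting))
    then show False using no_first_quadrant[OF A0, of y] A_eq[of y] by (simp add: zero_less_mult_iff)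
  qed
qed

end

section \<open>Absence of jumps and the planar vector field\<close>

lemma deriv_from_products:
  fixes s d A B :: "real \<Rightarrow> real"
  assumes cs: "isCont s x" and cd: "isCont d x"
    and AB: "\<forall>\<^sub>F y in at x. A y = s y * d y \<and> B y = 3 * (s y)\<^sup>2 - (d y)\<^sup>2"
    and ABx: "A x = s x * d x" "B x = 3 * (s x)\<^sup>2 - (d x)\<^sup>2"
    and A': "(A has_real_derivative a) (at x)" and B': "(B has_real_derivative b) (at x)"
    and nz: "d x \<noteq> 0"
  shows "(s has_real_derivative (s x * b / 2 + d x * a) / (3 * (s x)\<^sup>2 + (d x)\<^sup>2)) (at x)"
    and "(d has_real_derivative (3 * s x * a - d x * b / 2) / (3 * (s x)\<^sup>2 + (d x)\<^sup>2)) (at x)"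
proof -
  \<comment> \<open>With midpoints as coefficients the increments of \<open>A\<close> and
    \<open>B\<close> are exactly linear in those of \<open>s\<close> and \<open>d\<close>. Solving
    for the latter amounts to dividing the difference quotient of the square of z by the sum of the
    two values of z, and \<open>Q\<close> is the squared modulus of their mean.\<close>
  define sb where "sb y = (s y + s x) / 2" for y
  define db where "db y = (d y + d x) / 2" for y
  define Q where "Q y = 3 * (sb y)\<^sup>2 + (db y)\<^sup>2" for y
  define a' where "a' y = (A y - A x) / (y - x)" for y
  define b' where "b' y = (B y - B x) / (y - x)" for y
  have s: "(s \<longlongrightarrow> s x) (at x)" and d: "(d \<longlongrightarrow> d x) (at x)" using cs cd by (simp_all add: isCont_def)
  have sb: "(sb \<longlongrightarrow> s x) (at x)" unfolding sb_def using tendsto_add[OF s tendsto_const[of "s x"]]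
    by (auto intro!: tendsto_eq_intros s)
  have db: "(db \<longlongrightarrow> d x) (at x)" unfolding db_def by (auto intro!: tendsto_eq_intros d)
  have Q: "(Q \<longlongrightarrow> 3 * (s x)\<^sup>2 + (d x)\<^sup>2) (at x)" unfolding Q_def by (intro tendsto_intros sb db)
  have Qx: "3 * (s x)\<^sup>2 + (d x)\<^sup>2 > 0" using nz by (simp add: add_nonneg_pos)
  have a': "(a' \<longlongrightarrow> a) (at x)" and b': "(b' \<longlongrightarrow> b) (at x)"
    using A' B' unfolding has_field_derivative_iff a'_def[abs_def] b'_def[abs_def] by simp_all
  have Qpos: "\<forall>\<^sub>F y in at x. Q y > 0" using Q Qx by (rule order_tendstoD)
  have neq: "\<forall>\<^sub>F y in at x. y \<noteq> x" by (auto simp: eventually_at_filter)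
  have "((\<lambda>y. (sb y * b' y / 2 + db y * a' y) / Q y) \<longlongrightarrow>
      (s x * b / 2 + d x * a) / (3 * (s x)\<^sup>2 + (d x)\<^sup>2)) (at x)"
    by (intro tendsto_intros sb db a' b' Q) (use Qx in auto)
  moreover have "\<forall>\<^sub>F y in at x. (sb y * b' y / 2 + db y * a' y) / Q y = (s y - s x) / (y - x)"
    using AB Qpos neq
  proof eventually_elim
    case (elim y)
    have "sb y * (B y - B x) / 2 + db y * (A y - A x) = (s y - s x) * Q y"
      unfolding sb_def db_def Q_def ABx elim(1)[THEN conjunct1] elim(1)[THEN conjunct2]
      by (simp add: field_simps power2_eq_square)
    moreover have "(sb y * b' y / 2 + db y * a' y) * (y - x)
        = sb y * (b' y * (y - x)) / 2 + db y * (a' y * (y - x))" by (simp add: field_simps)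
    ultimately have "(sb y * b' y / 2 + db y * a' y) * (y - x) = (s y - s x) * Q y"
      using elim by (simp add: a'_def b'_def)
    then show ?case using elim by (simp add: frac_eq_eq)
  qed
  ultimately show "(s has_real_derivative (s x * b / 2 + d x * a) / (3 * (s x)\<^sup>2 + (d x)\<^sup>2)) (at x)"
    unfolding has_field_derivative_iff by (rule Lim_transform_eventually)
  have "((\<lambda>y. (3 * sb y * a' y - db y * b' y / 2) / Q y) \<longlongrightarrow>
      (3 * s x * a - d x * b / 2) / (3 * (s x)\<^sup>2 + (d x)\<^sup>2)) (at x)"
    by (intro tendsto_intros sb db a' b' Q) (use Qx in auto)
  moreover have "\<forall>\<^sub>F y in at x. (3 * sb y * a' y - db y * b' y / 2) / Q y = (d y - d x) / (y - x)"
    using AB Qpos neq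
  proof eventually_elim
    case (elim y)
    have "3 * sb y * (A y - A x) - db y * (B y - B x) / 2 = (d y - d x) * Q y"
      unfolding sb_def db_def Q_def ABx elim(1)[THEN conjunct1] elim(1)[THEN conjunct2]
      by (simp add: field_simps power2_eq_square)
    moreover have "(3 * sb y * a' y - db y * b' y / 2) * (y - x)
        = 3 * sb y * (a' y * (y - x)) - db y * (b' y * (y - x)) / 2" by (simp add: field_simps)
    ultimately have "(3 * sb y * a' y - db y * b' y / 2) * (y - x) = (d y - d x) * Q y"
      using elim by (simp add: a'_def b'_def)
    then show ?case using elim by (simp add: frac_eq_eq)
  qed
  ultimately show "(d has_real_derivative (3 * s x * a - d x * b / 2) / (3 * (s x)\<^sup>2 + (d x)\<^sup>2)) (at x)"
    unfolding has_field_derivative_iff by (rule Lim_transform_eventually)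
qed

lemma has_real_derivative_at_split:
  fixes f :: "real \<Rightarrow> real"
  assumes "(f has_real_derivative D) (at_left x)" "(f has_real_derivative D) (at_right x)"
  shows "(f has_real_derivative D) (at x)"
  using assms unfolding has_field_derivative_iff by (simp add: filterlim_at_split)

context half_line_flow
begin

text \<open>A jump would put both \<open>d x\<close> and \<open>dl x = - d x\<close> into the closed
  lower half plane, so \<open>d x = 0\<close>. Then \<open>s x = 0\<close> as well, and the jump is
  trivial.\<close>

lemma no_jump:
  assumes A0: "A 0 \<le> 0" and x: "0 < x"
  shows "sl x = s x" "dl x = d x"
proof -
  have "\<forall>\<^sub>F y in at_left x. d y \<le> 0"
    using x lower_half_plane[OF A0] by (fastforce simp: eventually_at_left_field)
  then have "dl x \<le> 0" using d_left[OF x] by (intro tendsto_upperbound) auto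
  then show "sl x = s x" "dl x = d x" using jump[OF x] lower_half_plane[OF A0 x] by auto
qed

lemma isCont_s: "A 0 \<le> 0 \<Longrightarrow> 0 < x \<Longrightarrow> isCont s x"
  using s_left[of x] s_right[of x] no_jump[of x] by (simp add: isCont_def filterlim_at_split)

lemma isCont_d: "A 0 \<le> 0 \<Longrightarrow> 0 < x \<Longrightarrow> isCont d x"
  using d_left[of x] d_right[of x] no_jump[of x] by (simp add: isCont_def filterlim_at_split)

lemma A_deriv: "A 0 \<le> 0 \<Longrightarrow> 0 < x \<Longrightarrow> (A has_real_derivative 2 * (\<delta> - d x)) (at x)"
  using A_left[of x] A_right[of x] no_jump[of x] by (intro has_real_derivative_at_split) auto

lemma B_deriv: "A 0 \<le> 0 \<Longrightarrow> 0 < x \<Longrightarrow> (B has_real_derivative 4 * (\<sigma> - s x)) (at x)"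
  using B_left[of x] B_right[of x] no_jump[of x] by (intro has_real_derivative_at_split) auto

text \<open>Together with \<open>d'\<close> the solution of
  \<open>s' * d + s * d' = 2 * (\<delta> - d)\<close> and
  \<open>6 * s * s' - 2 * d * d' = 4 * (\<sigma> - s)\<close>, the differentiated equations for
  \<open>A\<close> and \<open>B\<close>. The denominator is the squared modulus of z.\<close>

definition s' where
  "s' x = 2 * (s x * (\<sigma> - s x) + d x * (\<delta> - d x)) / (3 * (s x)\<^sup>2 + (d x)\<^sup>2)"

definition d' where
  "d' x = (6 * s x * \<delta> - 2 * d x * \<sigma> - 4 * s x * d x) / (3 * (s x)\<^sup>2 + (d x)\<^sup>2)"

lemma
  assumes A0: "A 0 \<le> 0" and x: "0 < x" and dx: "d x \<noteq> 0"
  shows s_deriv: "(s has_real_derivative s' x) (at x)"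
    and d_deriv: "(d has_real_derivative d' x) (at x)"
proof -
  have "\<forall>\<^sub>F y in at x. y > 0"
    using x by (intro order_tendstoD(1)[OF tendsto_ident_at])
  then have "\<forall>\<^sub>F y in at x. A y = s y * d y \<and> B y = 3 * (s y)\<^sup>2 - (d y)\<^sup>2"
    by eventually_elim (simp add: A_eq B_eq)
  note D = deriv_from_products[OF isCont_s[OF A0 x] isCont_d[OF A0 x] this A_eq B_eq
      A_deriv[OF A0 x] B_deriv[OF A0 x] dx]
  have "(s x * (4 * (\<sigma> - s x)) / 2 + d x * (2 * (\<delta> - d x))) = 2 * (s x * (\<sigma> - s x) + d x * (\<delta> - d x))"
    by (simp add: field_simps)
  then show "(s has_real_derivative s' x) (at x)" using D(1) x by (simp add: s'_def)
  have "(3 * s x * (2 * (\<delta> - d x)) - d x * (4 * (\<sigma> - s x)) / 2) = 6 * s x * \<delta> - 2 * d x * \<sigma> - 4 * s x * d x"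
    by (simp add: field_simps)
  then show "(d has_real_derivative d' x) (at x)" using D(2) x by (simp add: d'_def)
qed

section \<open>Distance from the equilibrium\<close>

text \<open>
  Up to scaling this is \<open>3 (Re w)\<^sup>2 + (Im w)\<^sup>2\<close> for \<open>w = z\<^sup>2 - (sqrt 3 * \<sigma> + \<i> * \<delta>)\<^sup>2\<close>. It increases wherever
  \<open>s < - \<sigma>\<close>, which repels the flow from the equilibrium.
\<close>
definition L where
  "L x = (B x - (3 * \<sigma>\<^sup>2 - \<delta>\<^sup>2))\<^sup>2 + 4 * (A x - \<sigma> * \<delta>)\<^sup>2"

lemma L_right:
  assumes x: "0 \<le> x"
  shows "(L has_real_derivative - 8 * (s x + \<sigma>) * (3 * (s x - \<sigma>)\<^sup>2 + (d x - \<delta>)\<^sup>2)) (at_right x)"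
proof -
  have "(L has_real_derivative 2 * (B x - (3 * \<sigma>\<^sup>2 - \<delta>\<^sup>2)) * (4 * (\<sigma> - s x))
      + 4 * (2 * (A x - \<sigma> * \<delta>) * (2 * (\<delta> - d x)))) (at_right x)"
    unfolding L_def
    by (rule derivative_eq_intros A_right B_right x refl | simp add: algebra_simps)+
  moreover have "2 * (B x - (3 * \<sigma>\<^sup>2 - \<delta>\<^sup>2)) * (4 * (\<sigma> - s x))
      + 4 * (2 * (A x - \<sigma> * \<delta>) * (2 * (\<delta> - d x)))
      = - 8 * (s x + \<sigma>) * (3 * (s x - \<sigma>)\<^sup>2 + (d x - \<delta>)\<^sup>2)"
    unfolding A_eq[OF x] B_eq[OF x] by algebra
  ultimately show ?thesis by simp
qed

text \<open>Where \<open>A \<le> 0\<close> one has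
  \<open>L \<ge> 4 * (\<sigma> * \<delta>)\<^sup>2\<close>. On the lower level
  \<open>2 * (\<sigma> * \<delta>)\<^sup>2\<close> therefore \<open>A > 0\<close>, which in the
  lower half plane means \<open>s < 0\<close>, and there \<open>L\<close> strictly increases. So the
  level is never crossed downwards.\<close>

lemma L_lower:
  assumes A0: "A 0 \<le> 0" and x: "0 \<le> x"
  shows "L x \<ge> 2 * (\<sigma> * \<delta>)\<^sup>2"
proof -
  have sd: "\<sigma> * \<delta> > 0" using sigma delta by (simp add: mult_neg_neg)
  have big: "L y > 2 * (\<sigma> * \<delta>)\<^sup>2" if "A y \<le> 0" for y
  proof -
    have "(\<sigma> * \<delta> - A y)\<^sup>2 \<ge> (\<sigma> * \<delta>)\<^sup>2" using that sd by (intro power_mono) auto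
    then have "L y \<ge> 4 * (\<sigma> * \<delta>)\<^sup>2" by (simp add: L_def power2_commute add_increasing)
    then show ?thesis using sd by (smt (verit) zero_less_power)
  qed
  have "- L x \<le> - (2 * (\<sigma> * \<delta>)\<^sup>2)"
  proof (rule barrier[where f="\<lambda>x. - L x" and a=0])
    show "continuous_on {0..} (\<lambda>x. - L x)" unfolding L_def
      by (intro continuous_intros A_cont B_cont)
    show "- L 0 \<le> - (2 * (\<sigma> * \<delta>)\<^sup>2)" using big[OF A0] by simp
    fix y assume y: "0 \<le> y" "- L y = - (2 * (\<sigma> * \<delta>)\<^sup>2)"
    then have Ay: "A y > 0" using big[of y] by force
    then have "y > 0" using y A0 by (cases "y = 0") auto
    then have "d y < 0" using lower_half_plane[OF A0] Ay A_eq[OF y(1)] by force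
    then have "s y < 0" using Ay A_eq[OF y(1)] by (simp add: zero_less_mult_iff)
    have "s y \<noteq> \<sigma> \<or> d y \<noteq> \<delta>"
      using y sd A_eq[OF y(1)] B_eq[OF y(1)] by (auto simp: L_def)
    then have "3 * (s y - \<sigma>)\<^sup>2 + (d y - \<delta>)\<^sup>2 > 0"
      by (metis add_nonneg_pos add_pos_nonneg mult_pos_pos right_minus_eq zero_le_power2 zero_less_numeral
          zero_less_power2 mult_nonneg_nonneg zero_le_numeral)
    then have "8 * (s y + \<sigma>) * (3 * (s y - \<sigma>)\<^sup>2 + (d y - \<delta>)\<^sup>2) < 0"
      using \<open>s y < 0\<close> sigma by (intro mult_neg_pos[of "8 * (s y + \<sigma>)"]) auto
    then show "\<exists>D<0. ((\<lambda>x. - L x) has_real_derivative D) (at_right y)"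
      using DERIV_minus[OF L_right[OF y(1)]]
      by (intro exI[of _ "8 * (s y + \<sigma>) * (3 * (s y - \<sigma>)\<^sup>2 + (d y - \<delta>)\<^sup>2)"]) (auto simp: algebra_simps)
  qed (rule x)
  then show ?thesis by simp
qed


section \<open>Confinement to a bounded strip\<close>

lemma denom_pos: "d x < 0 \<Longrightarrow> 3 * (s x)\<^sup>2 + (d x)\<^sup>2 > 0"
  by (simp add: add_nonneg_pos)

lemma s'_neg:
  assumes d: "d x < 0" and s: "s x * (\<sigma> - s x) \<le> - (\<delta>\<^sup>2)"
  shows "s' x < 0"
proof -
  have "d x * (\<delta> - d x) \<le> \<delta>\<^sup>2 / 4"
    using zero_le_power2[of "d x - \<delta> / 2"] by (simp add: power2_eq_square field_simps)
  moreover have "\<delta>\<^sup>2 > 0" using delta by simp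
  ultimately have "s x * (\<sigma> - s x) + d x * (\<delta> - d x) < 0" using s by linarith
  then have "2 * (s x * (\<sigma> - s x) + d x * (\<delta> - d x)) < 0" by (rule mult_pos_neg[OF zero_less_numeral])
  then show ?thesis unfolding s'_def using denom_pos[OF d] by (rule divide_neg_pos)
qed

lemma s_upper:
  assumes A0: "A 0 \<le> 0" and x1: "0 < x1" and M: "\<bar>\<sigma>\<bar> + \<bar>\<delta>\<bar> \<le> M" "s x1 \<le> M" and x: "x1 \<le> x"
  shows "s x \<le> M"
proof (rule barrier[where f=s, OF _ M(2) _ x])
  show "continuous_on {x1..} s" using isCont_s[OF A0] x1 by (auto intro!: continuous_at_imp_continuous_on)
  fix y assume y: "x1 \<le> y" "s y = M"
  then have dy: "d y < 0" using lower_half_plane[OF A0, of y] x1 M(1) delta by auto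
  have "M * (M - \<sigma>) \<ge> \<bar>\<delta>\<bar> * \<bar>\<delta>\<bar>" using M sigma by (intro mult_mono) auto
  then have "s y * (\<sigma> - s y) \<le> - (\<delta>\<^sup>2)" using y by (simp add: power2_eq_square algebra_simps)
  then show "\<exists>D<0. (s has_real_derivative D) (at_right y)"
    using s'_neg[OF dy] s_deriv[OF A0, of y] y x1 dy by (auto intro: has_field_derivative_at_within)
qed

text \<open>The flow cannot come back from beyond the line \<open>s = \<sigma> + \<delta>\<close>,
  where \<open>s'\<close> is negative. Beyond it \<open>B\<close> has slope
  \<open>4 * (\<sigma> - s) \<ge> - 4 * \<delta>\<close>, and \<open>B \<le> (2 * s)\<^sup>2\<close>
  makes this slope comparable to \<open>sqrt B\<close>, so \<open>B\<close> grows
  superlinearly.\<close>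

lemma s_lower:
  assumes A0: "A 0 \<le> 0" and x1: "0 < x1"
  shows "s x1 > \<sigma> + \<delta>"
proof (rule ccontr)
  assume "\<not> ?thesis"
  then have init: "s x1 \<le> \<sigma> + \<delta>" by simp
  have s: "s x \<le> \<sigma> + \<delta>" if x: "x1 \<le> x" for x
  proof (rule barrier[where f=s, OF _ init _ x])
    show "continuous_on {x1..} s" using isCont_s[OF A0] x1 by (auto intro!: continuous_at_imp_continuous_on)
    fix y assume y: "x1 \<le> y" "s y = \<sigma> + \<delta>"
    then have dy: "d y < 0" using lower_half_plane[OF A0, of y] x1 sigma delta by auto
    have "\<sigma> * \<delta> > 0" using sigma delta by (rule mult_neg_neg)
    then have "s y * (\<sigma> - s y) \<le> - (\<delta>\<^sup>2)" using y by (simp add: power2_eq_square algebra_simps)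
    then show "\<exists>D<0. (s has_real_derivative D) (at_right y)"
      using s'_neg[OF dy] s_deriv[OF A0, of y] y x1 dy by (auto intro: has_field_derivative_at_within)
  qed
  show False
  proof (rule superlinear_growth_contradiction[where a=x1 and G=B and S=B and \<epsilon>="- 4 * \<delta>"
        and k=2 and C'="- 4 * \<sigma>" and C=C])
    show "continuous_on {x1..} B" using x1 by (intro cont_B) simp
    then show "continuous_on {x1..} B" .
    fix x assume x: "x1 \<le> x"
    then have x0: "0 \<le> x" using x1 by simp
    show "\<exists>D\<ge>- 4 * \<delta>. (B has_real_derivative D) (at_right x)"
      using B_right[OF x0] s[OF x] by (intro exI[of _ "4 * (\<sigma> - s x)"]) auto
    show "B x \<le> C * (1 + x)" using B_growth[OF x0] by simp
    assume "0 < B x"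
    have "B x \<le> (2 * s x)\<^sup>2" using B_eq[OF x0] by (simp add: power2_eq_square)
    then have "sqrt (B x) \<le> 2 * \<bar>s x\<bar>" using real_sqrt_le_mono[of "B x" "(2 * s x)\<^sup>2"] by (simp only: real_sqrt_abs abs_mult) simp
    then show "\<exists>D\<ge>2 * sqrt (B x) - - 4 * \<sigma>. (B has_real_derivative D) (at_right x)"
      using B_right[OF x0] s[OF x] sigma delta by (intro exI[of _ "4 * (\<sigma> - s x)"]) auto
  qed (use delta in auto)
qed

text \<open>Below this line the slope of \<open>A\<close> is at least \<open>- \<delta> / 2\<close>.
  Once \<open>A > 0\<close>, both \<open>s\<close> and \<open>d\<close> are negative, and the slope
  of \<open>A + B\<close> dominates \<open>4 * sqrt A\<close> up to a constant. The factor 5/4 lies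
  strictly between 1, the equilibrium, and 3/2, the pole of \<open>J\<close>.\<close>

lemma d_not_below:
  assumes A0: "A 0 \<le> 0" and x1: "0 < x1" and d: "\<And>x. x1 \<le> x \<Longrightarrow> d x \<le> 5 / 4 * \<delta>"
  shows False
proof (rule superlinear_growth_contradiction[where a=x1 and G=A and S="\<lambda>x. A x + B x" and \<epsilon>="- \<delta> / 2"
      and k=4 and C'="- 4 * \<sigma> - 2 * \<delta>" and C="2 * C"])
  show "continuous_on {x1..} A" "continuous_on {x1..} (\<lambda>x. A x + B x)"
    using x1 by (auto intro!: continuous_intros cont_A cont_B)
  fix x assume x: "x1 \<le> x"
  then have x0: "0 \<le> x" using x1 by simp
  show "\<exists>D\<ge>- \<delta> / 2. (A has_real_derivative D) (at_right x)"
    using A_right[OF x0] d[OF x] by (intro exI[of _ "2 * (\<delta> - d x)"]) auto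
  show "A x + B x \<le> 2 * C * (1 + x)" using A_growth[OF x0] B_growth[OF x0] by (simp add: abs_le_iff)
  assume Ax: "0 < A x"
  have dx: "d x < 0" using d[OF x] delta by linarith
  then have sx: "s x < 0" using Ax A_eq[OF x0] by (simp add: zero_less_mult_iff)
  have "sqrt (A x) \<le> (\<bar>s x\<bar> + \<bar>d x\<bar>) / 2"
    using sqrt_mult_le_half_sum[of "s x" "d x"] A_eq[OF x0] Ax by simp
  then have "4 * sqrt (A x) - (- 4 * \<sigma> - 2 * \<delta>) \<le> 2 * (\<delta> - d x) + 4 * (\<sigma> - s x)"
    using sx dx by simp
  then show "\<exists>D\<ge>4 * sqrt (A x) - (- 4 * \<sigma> - 2 * \<delta>). ((\<lambda>x. A x + B x) has_real_derivative D) (at_right x)"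
    using DERIV_add[OF A_right[OF x0] B_right[OF x0]] by blast
qed (use delta in auto)

lemma d_lower:
  assumes A0: "A 0 \<le> 0" and x1: "0 < x1"
  shows "d x1 > 3 / 2 * \<delta>"
proof (rule ccontr)
  assume "\<not> ?thesis"
  then have init: "d x1 \<le> 3 / 2 * \<delta>" by simp
  have "d x \<le> 3 / 2 * \<delta>" if x: "x1 \<le> x" for x
  proof (rule barrier[where f=d, OF _ init _ x])
    show "continuous_on {x1..} d" using isCont_d[OF A0] x1 by (auto intro!: continuous_at_imp_continuous_on)
    fix y assume y: "x1 \<le> y" "d y = 3 / 2 * \<delta>"
    then have dy: "d y < 0" using delta by simp
    \<comment> \<open>The terms with \<open>s\<close> cancel exactly on this line, which is the
      origin of the factor 3/2: for \<sigma> = 0 the line would be invariant.\<close>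
    have "6 * s y * \<delta> - 2 * d y * \<sigma> - 4 * s y * d y = - 3 * (\<sigma> * \<delta>)" unfolding y(2) by simp
    also have "\<dots> < 0" using sigma delta by (simp add: mult_neg_neg)
    finally have "d' y < 0" unfolding d'_def using denom_pos[OF dy] by (rule divide_neg_pos)
    then show "\<exists>D<0. (d has_real_derivative D) (at_right y)"
      using d_deriv[OF A0, of y] y x1 dy by (auto intro: has_field_derivative_at_within)
  qed
  moreover have "3 / 2 * \<delta> \<le> 5 / 4 * \<delta>" using delta by simp
  ultimately show False using d_not_below[OF A0 x1] by (meson order_trans)
qed

section \<open>A strict Lyapunov function\<close>

text \<open>
  Without its last term, and for \<open>\<sigma> = 0\<close>, this is the first integral of the reversible system, whose orbits
  are the level sets; it comes from the orbit equation, which is linear in \<open>s\<^sup>2\<close> as a function of \<open>d\<close>.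
  The last term makes the derivative for \<open>\<sigma> < 0\<close> a multiple of \<open>(d - \<delta>)\<^sup>2\<close> with positive factor.
\<close>
definition J where
  "J x = ((s x)\<^sup>2 + 3 / 4 * \<delta>\<^sup>2) / (d x - 3 / 2 * \<delta>) - (d x - 3 / 2 * \<delta>)
    - 2 * \<delta> * ln (d x - 3 / 2 * \<delta>) + 4 * \<sigma> / \<delta>\<^sup>2 * A x"

lemma J_deriv:
  assumes A0: "A 0 \<le> 0" and x: "0 < x" and dx: "d x < 0"
  shows "(J has_real_derivative 2 * \<sigma> * (d x - \<delta>) * (1 / (d x - 3 / 2 * \<delta>)\<^sup>2 - 4 / \<delta>\<^sup>2)) (at x)"
proof -
  define t where "t = d x - 3 / 2 * \<delta>"
  have t: "t > 0" using d_lower[OF A0 x] by (simp add: t_def)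
  have dnz: "d x \<noteq> 0" using dx by simp
  define Q where "Q = 3 * (s x)\<^sup>2 + (d x)\<^sup>2"
  have Q: "Q > 0" using denom_pos[OF dx] by (simp add: Q_def)
  have Qs: "Q * s' x = 2 * (s x * (\<sigma> - s x) + d x * (\<delta> - d x))"
    and Qd: "Q * d' x = 6 * s x * \<delta> - 2 * d x * \<sigma> - 4 * s x * d x"
    using Q by (simp_all add: s'_def d'_def Q_def)
  \<comment> \<open>Multiplication by \<open>Q\<close> clears the denominators of the vector field.
    Every term without \<sigma> cancels, as it must for a first integral of the case \<sigma> =
    0.\<close>
  have "Q * (2 * s x * t * s' x - ((s x)\<^sup>2 + d x * (d x - \<delta>)) * d' x)
      = 2 * s x * t * (Q * s' x) - ((s x)\<^sup>2 + d x * (d x - \<delta>)) * (Q * d' x)"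
    by (simp add: algebra_simps)
  also have "\<dots> = Q * (2 * \<sigma> * (d x - \<delta>))"
    unfolding Qs Qd unfolding t_def Q_def by (simp add: field_simps power2_eq_square)
  finally have key: "2 * s x * t * s' x - ((s x)\<^sup>2 + d x * (d x - \<delta>)) * d' x = 2 * \<sigma> * (d x - \<delta>)"
    using Q by simp
  have dt: "((\<lambda>x. d x - 3 / 2 * \<delta>) has_real_derivative d' x) (at x)"
    using DERIV_diff[OF d_deriv[OF A0 x dnz] DERIV_const] by simp
  have ds: "((\<lambda>x. (s x)\<^sup>2 + 3 / 4 * \<delta>\<^sup>2) has_real_derivative 2 * s x * s' x) (at x)"
    using DERIV_add[OF DERIV_power[OF s_deriv[OF A0 x dnz], of 2] DERIV_const[of "3 / 4 * \<delta>\<^sup>2"]]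
    by (simp add: mult_ac)
  have dl: "((\<lambda>x. ln (d x - 3 / 2 * \<delta>)) has_real_derivative inverse t * d' x) (at x)"
    using DERIV_chain2[of ln "inverse t" "\<lambda>x. d x - 3 / 2 * \<delta>", OF _ dt] DERIV_ln[OF t] by (simp add: t_def)
  have "(J has_real_derivative
      (2 * s x * s' x * t - ((s x)\<^sup>2 + 3 / 4 * \<delta>\<^sup>2) * d' x) / (t * t) - d' x
      - 2 * \<delta> * (inverse t * d' x) + 4 * \<sigma> / \<delta>\<^sup>2 * (2 * (\<delta> - d x))) (at x)"
    unfolding J_def t_def
    by (rule DERIV_add[OF DERIV_diff[OF DERIV_diff[OF DERIV_divide[OF ds dt] dt] DERIV_cmult[OF dl[unfolded t_def]]]
          DERIV_cmult[OF A_deriv[OF A0 x]]]) (use t t_def in simp)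
  moreover have "(2 * s x * s' x * t - ((s x)\<^sup>2 + 3 / 4 * \<delta>\<^sup>2) * d' x) / (t * t) - d' x - 2 * \<delta> * (inverse t * d' x)
      = (2 * s x * t * s' x - ((s x)\<^sup>2 + 3 / 4 * \<delta>\<^sup>2 + t\<^sup>2 + 2 * \<delta> * t) * d' x) / t\<^sup>2"
  proof -
    have "(a * t - k * e) / (t * t) - e - 2 * \<delta> * (inverse t * e) = (a * t - (k + t\<^sup>2 + 2 * \<delta> * t) * e) / t\<^sup>2"
      for a k e :: real using t by (simp add: field_simps power2_eq_square)
    from this[of "2 * s x * s' x" "(s x)\<^sup>2 + 3 / 4 * \<delta>\<^sup>2" "d' x"] show ?thesis by (simp only: mult.assoc mult.commute mult.left_commute)
  qed
  moreover
  \<comment> \<open>This identity accounts for the constant \<open>3 / 4 * \<delta>\<^sup>2\<close>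
    and the factor \<open>- 2 * \<delta>\<close> of the logarithm in \<open>J\<close>.\<close>
  have "3 / 4 * \<delta>\<^sup>2 + t\<^sup>2 + 2 * \<delta> * t = d x * (d x - \<delta>)"
    by (simp add: t_def field_simps power2_eq_square)
  then have "(s x)\<^sup>2 + 3 / 4 * \<delta>\<^sup>2 + t\<^sup>2 + 2 * \<delta> * t = (s x)\<^sup>2 + d x * (d x - \<delta>)" by linarith
  ultimately have "(J has_real_derivative 2 * \<sigma> * (d x - \<delta>) / t\<^sup>2 + 4 * \<sigma> / \<delta>\<^sup>2 * (2 * (\<delta> - d x))) (at x)"
    using key by (simp only:)
  \<comment> \<open>On \<open>d = \<delta>\<close> one has
    \<open>t\<^sup>2 = \<delta>\<^sup>2 / 4\<close>, so the last bracket vanishes there; this fixes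
    the coefficient of \<open>A\<close> in \<open>J\<close>.\<close>
  moreover have "2 * \<sigma> * (d x - \<delta>) / t\<^sup>2 + 4 * \<sigma> / \<delta>\<^sup>2 * (2 * (\<delta> - d x))
     = 2 * \<sigma> * (d x - \<delta>) * (1 / t\<^sup>2 - 4 / \<delta>\<^sup>2)"
  proof -
    have "2 * \<sigma> * e / p + 4 * \<sigma> / q * (2 * (- e)) = 2 * \<sigma> * e * (1 / p - 4 / q)" for e p q :: real
      by (simp add: right_diff_distrib)
    from this[of "d x - \<delta>"] show ?thesis by simp
  qed
  ultimately show ?thesis by (simp add: t_def)
qed


text \<open>
  The derivative of \<open>J\<close> vanishes on the line \<open>d = \<delta>\<close>; on it that of \<open>\<psi>\<close> is \<open>- 4 * \<delta> * (s - \<sigma>)\<^sup>2\<close>, so a small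
  multiple of \<open>\<psi>\<close> added to \<open>J\<close> gives a strict Lyapunov function.
\<close>
definition \<psi> where
  "\<psi> x = (A x - \<sigma> * \<delta>) * (B x - (3 * \<sigma>\<^sup>2 - \<delta>\<^sup>2))"

lemma \<psi>_deriv:
  assumes A0: "A 0 \<le> 0" and x: "0 < x"
  shows "(\<psi> has_real_derivative - 4 * \<delta> * (s x - \<sigma>)\<^sup>2 - (s x - \<sigma>) * (d x - \<delta>) * (10 * s x + 6 * \<sigma>)
    + 2 * (d x - \<delta>)\<^sup>2 * (d x + \<delta>)) (at x)"
proof -
  have "(\<psi> has_real_derivative (A x - \<sigma> * \<delta>) * (4 * (\<sigma> - s x))
     + 2 * (\<delta> - d x) * (B x - (3 * \<sigma>\<^sup>2 - \<delta>\<^sup>2))) (at x)"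
    unfolding \<psi>_def
    by (rule derivative_eq_intros A_deriv[OF A0 x] B_deriv[OF A0 x] refl | simp)+
  moreover have "(A x - \<sigma> * \<delta>) * (4 * (\<sigma> - s x)) + 2 * (\<delta> - d x) * (B x - (3 * \<sigma>\<^sup>2 - \<delta>\<^sup>2))
     = - 4 * \<delta> * (s x - \<sigma>)\<^sup>2 - (s x - \<sigma>) * (d x - \<delta>) * (10 * s x + 6 * \<sigma>)
    + 2 * (d x - \<delta>)\<^sup>2 * (d x + \<delta>)"
    unfolding A_eq[OF less_imp_le[OF x]] B_eq[OF less_imp_le[OF x]] by algebra
  ultimately show ?thesis by simp
qed

text \<open>Completing the square spends half of
  \<open>- 4 * \<delta> * (s - \<sigma>)\<^sup>2\<close> on the mixed term. What is lost is a
  multiple of \<open>(d - \<delta>)\<^sup>2\<close>, with \<open>5 * \<delta>\<close> coming from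
  \<open>d + \<delta> > 5 / 2 * \<delta>\<close>.\<close>

lemma \<psi>_deriv_lower:
  assumes s: "\<bar>s x\<bar> \<le> R" and dx: "3 / 2 * \<delta> < d x" "d x < 0"
  shows "- 4 * \<delta> * (s x - \<sigma>)\<^sup>2 - (s x - \<sigma>) * (d x - \<delta>) * (10 * s x + 6 * \<sigma>)
    + 2 * (d x - \<delta>)\<^sup>2 * (d x + \<delta>)
    \<ge> - 2 * \<delta> * (s x - \<sigma>)\<^sup>2 - ((10 * R - 6 * \<sigma>)\<^sup>2 / (- 8 * \<delta>) - 5 * \<delta>) * (d x - \<delta>)\<^sup>2"
proof -
  define \<xi> \<upsilon> H where "\<xi> = s x - \<sigma>" and "\<upsilon> = d x - \<delta>" and "H = 10 * s x + 6 * \<sigma>"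
  have "\<bar>H\<bar> \<le> 10 * R - 6 * \<sigma>" using s sigma by (auto simp: H_def abs_le_iff)
  then have H2: "H\<^sup>2 \<le> (10 * R - 6 * \<sigma>)\<^sup>2" by (metis abs_ge_zero abs_le_square_iff abs_of_nonneg order_trans)
  have "0 \<le> (4 * \<delta> * \<xi> + H * \<upsilon>)\<^sup>2 / (- 8 * \<delta>)" using delta by (intro divide_nonneg_pos) auto
  also have "\<dots> = - 2 * \<delta> * \<xi>\<^sup>2 - \<xi> * \<upsilon> * H + H\<^sup>2 / (- 8 * \<delta>) * \<upsilon>\<^sup>2"
    using delta by (simp add: field_simps power2_eq_square)
  also have "\<dots> \<le> - 2 * \<delta> * \<xi>\<^sup>2 - \<xi> * \<upsilon> * H + (10 * R - 6 * \<sigma>)\<^sup>2 / (- 8 * \<delta>) * \<upsilon>\<^sup>2"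
    by (intro add_left_mono mult_right_mono divide_right_mono H2) (use delta in auto)
  finally have *: "- \<xi> * \<upsilon> * H \<ge> 2 * \<delta> * \<xi>\<^sup>2 - (10 * R - 6 * \<sigma>)\<^sup>2 / (- 8 * \<delta>) * \<upsilon>\<^sup>2" by simp
  have "\<upsilon>\<^sup>2 * (5 * \<delta>) \<le> \<upsilon>\<^sup>2 * (2 * (d x + \<delta>))" using dx by (intro mult_left_mono) auto
  with * have "- 4 * \<delta> * \<xi>\<^sup>2 - \<xi> * \<upsilon> * H + 2 * \<upsilon>\<^sup>2 * (d x + \<delta>)
      \<ge> - 2 * \<delta> * \<xi>\<^sup>2 - ((10 * R - 6 * \<sigma>)\<^sup>2 / (- 8 * \<delta>) - 5 * \<delta>) * \<upsilon>\<^sup>2"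
    by (simp add: algebra_simps)
  then show ?thesis by (simp add: \<xi>_def \<upsilon>_def H_def)
qed

text \<open>With \<open>t = d - 3 / 2 * \<delta>\<close> one has
  \<open>2 * t + \<delta> = 2 * (d - \<delta>)\<close>, so the difference of reciprocal squares
  yields a second factor \<open>d - \<delta>\<close>. The remaining factor is estimated by
  \<open>0 < t \<le> - 3 / 2 * \<delta>\<close>.\<close>

lemma J_deriv_lower:
  assumes dx: "3 / 2 * \<delta> < d x" "d x < 0"
  shows "2 * \<sigma> * (d x - \<delta>) * (1 / (d x - 3 / 2 * \<delta>)\<^sup>2 - 4 / \<delta>\<^sup>2)
    \<ge> 16 * \<sigma> / (9 * \<delta> ^ 3) * (d x - \<delta>)\<^sup>2"
proof -
  define t where "t = d x - 3 / 2 * \<delta>"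
  have t: "0 < t" "t \<le> - 3 / 2 * \<delta>" using dx by (auto simp: t_def)
  have "2 * \<sigma> * (d x - \<delta>) * (1 / t\<^sup>2 - 4 / \<delta>\<^sup>2) = (- 4 * \<sigma>) * (2 * t - \<delta>) / (\<delta>\<^sup>2 * t\<^sup>2) * (d x - \<delta>)\<^sup>2"
  proof -
    have "1 / t\<^sup>2 - 4 / \<delta>\<^sup>2 = (\<delta>\<^sup>2 - 4 * t\<^sup>2) / (\<delta>\<^sup>2 * t\<^sup>2)"
      using t(1) delta by (simp add: diff_frac_eq mult.commute)
    moreover have "\<delta>\<^sup>2 - 4 * t\<^sup>2 = - 2 * (d x - \<delta>) * (2 * t - \<delta>)"
      unfolding t_def by (simp add: power2_eq_square field_simps)
    ultimately have "1 / t\<^sup>2 - 4 / \<delta>\<^sup>2 = - 2 * (d x - \<delta>) * (2 * t - \<delta>) / (\<delta>\<^sup>2 * t\<^sup>2)" by simp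
    then have "2 * \<sigma> * (d x - \<delta>) * (1 / t\<^sup>2 - 4 / \<delta>\<^sup>2)
        = 2 * \<sigma> * (d x - \<delta>) * (- 2 * (d x - \<delta>) * (2 * t - \<delta>)) / (\<delta>\<^sup>2 * t\<^sup>2)"
      by (simp only: times_divide_eq_right)
    also have "2 * \<sigma> * (d x - \<delta>) * (- 2 * (d x - \<delta>) * (2 * t - \<delta>))
        = (- 4 * \<sigma>) * (2 * t - \<delta>) * (d x - \<delta>)\<^sup>2" by algebra
    finally show ?thesis by simp
  qed
  moreover have "16 * \<sigma> / (9 * \<delta> ^ 3) \<le> (- 4 * \<sigma>) * (2 * t - \<delta>) / (\<delta>\<^sup>2 * t\<^sup>2)"
  proof -
    have "t\<^sup>2 \<le> (- 3 / 2 * \<delta>)\<^sup>2" using t by (intro power_mono) auto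
    then have "t\<^sup>2 \<le> 9 / 4 * \<delta>\<^sup>2" by (simp add: power2_eq_square)
    then have den: "\<delta>\<^sup>2 * t\<^sup>2 \<le> \<delta>\<^sup>2 * (9 / 4 * \<delta>\<^sup>2)" by (rule mult_left_mono) simp
    have num: "(- 4 * \<sigma>) * (- \<delta>) \<le> (- 4 * \<sigma>) * (2 * t - \<delta>)" by (rule mult_left_mono) (use sigma t in auto)
    have "(- 4 * \<sigma>) * (- \<delta>) \<ge> 0" using sigma delta by (simp add: mult_neg_neg less_imp_le)
    with num have nonneg: "(- 4 * \<sigma>) * (2 * t - \<delta>) \<ge> 0" by (rule order_trans[rotated])
    have "\<delta>\<^sup>2 * t\<^sup>2 > 0" using delta t by simp
    then have "(- 4 * \<sigma>) * (- \<delta>) / (\<delta>\<^sup>2 * (9 / 4 * \<delta>\<^sup>2)) \<le> (- 4 * \<sigma>) * (2 * t - \<delta>) / (\<delta>\<^sup>2 * t\<^sup>2)"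
      by (rule frac_le[OF nonneg num _ den])
    moreover have "(- 4 * \<sigma>) * (- \<delta>) / (\<delta>\<^sup>2 * (9 / 4 * \<delta>\<^sup>2)) = 16 * \<sigma> / (9 * \<delta> ^ 3)"
      using delta by (simp add: field_simps power2_eq_square power3_eq_cube)
    ultimately show ?thesis by simp
  qed
  ultimately show ?thesis unfolding t_def[symmetric] by (simp only: mult_right_mono zero_le_power2)
qed

text \<open>A difference of two squares contains the factor z minus its equilibrium value, and the
  other factor is bounded in the strip. This turns the lower bound for \<open>L\<close> into one for
  the distance to the equilibrium. The coefficient is crude; 13 rounds up 25/2.\<close>

lemma L_upper:
  assumes x: "0 \<le> x" and s: "\<bar>s x\<bar> \<le> R" and dx: "3 / 2 * \<delta> < d x" "d x \<le> 0"
  shows "L x \<le> (18 * (R - \<sigma>)\<^sup>2 + 13 * \<delta>\<^sup>2 + 8 * R\<^sup>2 + 8 * \<delta>\<^sup>2) * ((s x - \<sigma>)\<^sup>2 + (d x - \<delta>)\<^sup>2)"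
proof -
  define \<xi> \<upsilon> where "\<xi> = s x - \<sigma>" and "\<upsilon> = d x - \<delta>"
  have sq: "(p + q)\<^sup>2 \<le> 2 * p\<^sup>2 + 2 * q\<^sup>2" for p q :: real
    using zero_le_power2[of "p - q"] by (simp add: power2_eq_square algebra_simps)
  have "L x = (3 * \<xi> * (s x + \<sigma>) + - (\<upsilon> * (d x + \<delta>)))\<^sup>2 + 4 * (s x * \<upsilon> + \<delta> * \<xi>)\<^sup>2"
    unfolding L_def \<xi>_def \<upsilon>_def A_eq[OF x] B_eq[OF x] by algebra
  also have "\<dots> \<le> (2 * (3 * \<xi> * (s x + \<sigma>))\<^sup>2 + 2 * (- (\<upsilon> * (d x + \<delta>)))\<^sup>2)
      + 4 * (2 * (s x * \<upsilon>)\<^sup>2 + 2 * (\<delta> * \<xi>)\<^sup>2)"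
    by (rule add_mono[OF sq mult_left_mono[OF sq]]) simp
  also have "\<dots> = (18 * (s x + \<sigma>)\<^sup>2 + 8 * \<delta>\<^sup>2) * \<xi>\<^sup>2 + (2 * (d x + \<delta>)\<^sup>2 + 8 * (s x)\<^sup>2) * \<upsilon>\<^sup>2"
    by (simp add: power2_eq_square algebra_simps)
  also have "\<dots> \<le> (18 * (R - \<sigma>)\<^sup>2 + 13 * \<delta>\<^sup>2 + 8 * R\<^sup>2 + 8 * \<delta>\<^sup>2) * \<xi>\<^sup>2
      + (18 * (R - \<sigma>)\<^sup>2 + 13 * \<delta>\<^sup>2 + 8 * R\<^sup>2 + 8 * \<delta>\<^sup>2) * \<upsilon>\<^sup>2"
  proof (rule add_mono; rule mult_right_mono)
    have "(s x + \<sigma>)\<^sup>2 \<le> (R - \<sigma>)\<^sup>2"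
      unfolding abs_le_square_iff[symmetric] using s sigma by linarith
    then show "18 * (s x + \<sigma>)\<^sup>2 + 8 * \<delta>\<^sup>2 \<le> 18 * (R - \<sigma>)\<^sup>2 + 13 * \<delta>\<^sup>2 + 8 * R\<^sup>2 + 8 * \<delta>\<^sup>2"
      using zero_le_power2[of R] zero_le_power2[of \<delta>] by linarith
    have "(s x)\<^sup>2 \<le> R\<^sup>2" unfolding abs_le_square_iff[symmetric] using s by linarith
    moreover have "(d x + \<delta>)\<^sup>2 \<le> (5 / 2 * \<delta>)\<^sup>2" unfolding abs_le_square_iff[symmetric] using dx delta by linarith
    then have "(d x + \<delta>)\<^sup>2 \<le> 25 / 4 * \<delta>\<^sup>2" by (simp only: power_mult_distrib) (simp add: power2_eq_square)
    then have "2 * (d x + \<delta>)\<^sup>2 \<le> 13 * \<delta>\<^sup>2" using zero_le_power2[of \<delta>] by linarith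
    ultimately show "2 * (d x + \<delta>)\<^sup>2 + 8 * (s x)\<^sup>2 \<le> 18 * (R - \<sigma>)\<^sup>2 + 13 * \<delta>\<^sup>2 + 8 * R\<^sup>2 + 8 * \<delta>\<^sup>2"
      using zero_le_power2[of "R - \<sigma>"] zero_le_power2[of \<delta>] by linarith
  qed auto
  finally show ?thesis by (simp add: \<xi>_def \<upsilon>_def distrib_left)
qed


text \<open>\<open>J\<close> has its pole at \<open>d = 3 / 2 * \<delta>\<close>, at distance at
  least \<open>- \<delta> / 4\<close> from the region considered; the logarithm needs only the bound
  \<open>ln t \<le> t\<close>.\<close>

lemma J_upper:
  assumes x: "0 \<le> x" and s: "\<bar>s x\<bar> \<le> R" and dx: "5 / 4 * \<delta> \<le> d x" "d x \<le> 0"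
  shows "J x \<le> (R\<^sup>2 + 3 / 4 * \<delta>\<^sup>2) / (- \<delta> / 4) + 3 * \<delta>\<^sup>2 + - 4 * \<sigma> / \<delta>\<^sup>2 * (R * (- 2 * \<delta>))"
proof -
  define t where "t = d x - 3 / 2 * \<delta>"
  have t: "- \<delta> / 4 \<le> t" "t \<le> - 3 / 2 * \<delta>" using dx by (auto simp: t_def)
  have tpos: "t > 0" using t delta by linarith
  have "(s x)\<^sup>2 \<le> R\<^sup>2" unfolding abs_le_square_iff[symmetric] using s by linarith
  then have 1: "((s x)\<^sup>2 + 3 / 4 * \<delta>\<^sup>2) / t \<le> (R\<^sup>2 + 3 / 4 * \<delta>\<^sup>2) / (- \<delta> / 4)"
    by (intro frac_le t) (use delta in auto)
  have "ln t \<le> - 3 / 2 * \<delta>" using ln_bound[OF tpos] t by linarith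
  then have "(- 2 * \<delta>) * ln t \<le> (- 2 * \<delta>) * (- 3 / 2 * \<delta>)" using delta by (intro mult_left_mono) auto
  then have 2: "- 2 * \<delta> * ln t \<le> 3 * \<delta>\<^sup>2" by (simp add: power2_eq_square)
  have "\<bar>A x\<bar> \<le> R * (- 2 * \<delta>)"
    unfolding A_eq[OF x] abs_mult using s dx delta by (intro mult_mono) auto
  then have "- 4 * \<sigma> / \<delta>\<^sup>2 * - A x \<le> - 4 * \<sigma> / \<delta>\<^sup>2 * (R * (- 2 * \<delta>))"
    using sigma by (intro mult_left_mono divide_nonneg_nonneg) auto
  then have 3: "4 * \<sigma> / \<delta>\<^sup>2 * A x \<le> - 4 * \<sigma> / \<delta>\<^sup>2 * (R * (- 2 * \<delta>))" by simp
  show ?thesis unfolding J_def t_def[symmetric] using 1 2 3 tpos by linarith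
qed

lemma \<psi>_upper:
  assumes x: "0 \<le> x" and s: "\<bar>s x\<bar> \<le> R" and dx: "3 / 2 * \<delta> < d x" "d x \<le> 0"
  shows "\<psi> x \<le> (18 * (R - \<sigma>)\<^sup>2 + 13 * \<delta>\<^sup>2 + 8 * R\<^sup>2 + 8 * \<delta>\<^sup>2) * ((R - \<sigma>)\<^sup>2 + \<delta>\<^sup>2)"
proof -
  \<comment> \<open>\<open>\<psi>\<close> is the product of the two quantities whose weighted
    squares add up to \<open>L\<close>.\<close>
  have "p * q \<le> q\<^sup>2 + 4 * p\<^sup>2" for p q :: real
    using zero_le_power2[of "2 * p - q"] zero_le_power2[of "2 * p + q"] zero_le_power2[of p] zero_le_power2[of q]
    by (simp add: power2_eq_square algebra_simps)
  then have "\<psi> x \<le> L x" by (simp add: \<psi>_def L_def)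
  also note L_upper[OF assms]
  also have "(s x - \<sigma>)\<^sup>2 + (d x - \<delta>)\<^sup>2 \<le> (R - \<sigma>)\<^sup>2 + \<delta>\<^sup>2"
  proof (rule add_mono)
    show "(s x - \<sigma>)\<^sup>2 \<le> (R - \<sigma>)\<^sup>2"
      unfolding abs_le_square_iff[symmetric] using s sigma by linarith
    show "(d x - \<delta>)\<^sup>2 \<le> \<delta>\<^sup>2"
      unfolding abs_le_square_iff[symmetric] using dx delta by linarith
  qed
  finally show ?thesis by (simp add: mult_left_mono)
qed

text \<open>\<open>J\<close> gains \<open>k * (d - \<delta>)\<^sup>2\<close>, while
  \<open>\<psi>\<close> gains in \<open>(s - \<sigma>)\<^sup>2\<close> but loses
  \<open>c * (d - \<delta>)\<^sup>2\<close>. With \<open>\<epsilon> = k / (2 * c)\<close> the loss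
  uses half of the gain of \<open>J\<close>. A multiple of the squared distance to the equilibrium
  remains, and \<open>L\<close> bounds it below uniformly.\<close>

lemma lyapunov_deriv:
  assumes A0: "A 0 \<le> 0" and x: "0 < x" and dx: "d x < 0" and s: "\<bar>s x\<bar> \<le> R"
    and k: "k = 16 * \<sigma> / (9 * \<delta> ^ 3)" and c: "c = (10 * R - 6 * \<sigma>)\<^sup>2 / (- 8 * \<delta>) - 5 * \<delta>"
    and \<epsilon>: "\<epsilon> = k / (2 * c)" and C2: "C2 = 18 * (R - \<sigma>)\<^sup>2 + 13 * \<delta>\<^sup>2 + 8 * R\<^sup>2 + 8 * \<delta>\<^sup>2"
  shows "\<exists>D\<ge>min (k / 2) (- 2 * \<delta> * \<epsilon>) * (2 * (\<sigma> * \<delta>)\<^sup>2) / C2.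
    ((\<lambda>x. J x + \<epsilon> * \<psi> x) has_real_derivative D) (at x)"
proof -
  have k0: "k > 0" unfolding k using sigma delta by (simp add: divide_neg_neg)
  have "(10 * R - 6 * \<sigma>)\<^sup>2 / (- 8 * \<delta>) \<ge> 0" using delta by (intro divide_nonneg_pos) auto
  then have c0: "c > 0" using delta unfolding c by linarith
  have \<epsilon>0: "\<epsilon> > 0" using k0 c0 by (simp add: \<epsilon>)
  have C20: "C2 > 0" unfolding C2 using delta zero_less_power2[of \<delta>] zero_le_power2[of R] zero_le_power2[of "R - \<sigma>"]
    by linarith
  define e where "e = min (k / 2) (- 2 * \<delta> * \<epsilon>)"
  have e: "e \<ge> 0" "e \<le> k / 2" "e \<le> - 2 * \<delta> * \<epsilon>"
    using k0 \<epsilon>0 delta by (auto simp: e_def mult_nonpos_nonneg)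
  define \<xi> \<upsilon> where "\<xi> = s x - \<sigma>" and "\<upsilon> = d x - \<delta>"
  define JD where "JD = 2 * \<sigma> * (d x - \<delta>) * (1 / (d x - 3 / 2 * \<delta>)\<^sup>2 - 4 / \<delta>\<^sup>2)"
  define PD where "PD = - 4 * \<delta> * (s x - \<sigma>)\<^sup>2 - (s x - \<sigma>) * (d x - \<delta>) * (10 * s x + 6 * \<sigma>)
    + 2 * (d x - \<delta>)\<^sup>2 * (d x + \<delta>)"
  note dl = d_lower[OF A0 x]
  have JD: "JD \<ge> k * \<upsilon>\<^sup>2" unfolding JD_def \<upsilon>_def k by (rule J_deriv_lower[OF dl dx])
  have PD: "PD \<ge> - 2 * \<delta> * \<xi>\<^sup>2 - c * \<upsilon>\<^sup>2" unfolding PD_def \<xi>_def \<upsilon>_def c by (rule \<psi>_deriv_lower[OF s dl dx])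
  have "e * (2 * (\<sigma> * \<delta>)\<^sup>2) / C2 \<le> e * L x / C2"
    using L_lower[OF A0, of x] x e C20 by (intro divide_right_mono mult_left_mono) auto
  also have "\<dots> \<le> e * (C2 * (\<xi>\<^sup>2 + \<upsilon>\<^sup>2)) / C2"
    using L_upper[OF _ s dl] x dx e C20 unfolding \<xi>_def \<upsilon>_def C2
    by (intro divide_right_mono mult_left_mono) auto
  also have "\<dots> = e * \<xi>\<^sup>2 + e * \<upsilon>\<^sup>2" using C20 by (simp add: field_simps)
  also have "\<dots> \<le> (- 2 * \<delta> * \<epsilon>) * \<xi>\<^sup>2 + k / 2 * \<upsilon>\<^sup>2"
    by (intro add_mono mult_right_mono e) auto
  also have "\<dots> = k * \<upsilon>\<^sup>2 + \<epsilon> * (- 2 * \<delta> * \<xi>\<^sup>2 - c * \<upsilon>\<^sup>2)"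
    using c0 by (simp add: \<epsilon> field_simps)
  also have "\<dots> \<le> JD + \<epsilon> * PD" using \<epsilon>0 by (intro add_mono JD mult_left_mono PD) auto
  finally have "e * (2 * (\<sigma> * \<delta>)\<^sup>2) / C2 \<le> JD + \<epsilon> * PD" .
  moreover have "((\<lambda>x. J x + \<epsilon> * \<psi> x) has_real_derivative JD + \<epsilon> * PD) (at x)"
    unfolding JD_def PD_def by (rule DERIV_add[OF J_deriv[OF A0 x dx] DERIV_cmult[OF \<psi>_deriv[OF A0 x]]])
  ultimately show ?thesis unfolding e_def by blast
qed

text \<open>If \<open>A 0 \<le> 0\<close>, the Lyapunov function \<open>N\<close> grows at a fixed
  rate, yet it is bounded above wherever \<open>d \<ge> 5 / 4 * \<delta>\<close>. So
  \<open>d\<close> eventually stays below this line, which forces superlinear growth.\<close>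

lemma A0_pos: "A 0 > 0"
proof (rule ccontr)
  assume "\<not> A 0 > 0"
  then have A0: "A 0 \<le> 0" by simp
  \<comment> \<open>The time 1 stands for any positive time: location in the lower half plane and
    continuity are known only after 0.\<close>
  define R where "R = max (s 1) (\<bar>\<sigma>\<bar> + \<bar>\<delta>\<bar>)"
  have sR: "\<bar>s x\<bar> \<le> R" if x: "x \<ge> 1" for x
    using s_upper[OF A0, of 1 R x] s_lower[OF A0, of x] x sigma delta by (auto simp: R_def)
  have dle: "d x \<le> 0" if "x \<ge> 1" for x using lower_half_plane[OF A0, of x] that by auto
  define k where "k = 16 * \<sigma> / (9 * \<delta> ^ 3)"
  define c where "c = (10 * R - 6 * \<sigma>)\<^sup>2 / (- 8 * \<delta>) - 5 * \<delta>"
  define \<epsilon> where "\<epsilon> = k / (2 * c)"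
  define C2 where "C2 = 18 * (R - \<sigma>)\<^sup>2 + 13 * \<delta>\<^sup>2 + 8 * R\<^sup>2 + 8 * \<delta>\<^sup>2"
  define e where "e = min (k / 2) (- 2 * \<delta> * \<epsilon>) * (2 * (\<sigma> * \<delta>)\<^sup>2) / C2"
  define N where "N x = J x + \<epsilon> * \<psi> x" for x
  have k0: "k > 0" unfolding k_def using sigma delta by (simp add: divide_neg_neg)
  have "(10 * R - 6 * \<sigma>)\<^sup>2 / (- 8 * \<delta>) \<ge> 0" using delta by (intro divide_nonneg_pos) auto
  then have c0: "c > 0" using delta unfolding c_def by linarith
  have \<epsilon>0: "\<epsilon> > 0" using k0 c0 by (simp add: \<epsilon>_def)
  have C20: "C2 > 0" unfolding C2_def
    using delta zero_less_power2[of \<delta>] zero_le_power2[of R] zero_le_power2[of "R - \<sigma>"] by linarith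
  have "min (k / 2) (- 2 * \<delta> * \<epsilon>) > 0" using k0 \<epsilon>0 delta by (simp add: mult_neg_pos)
  moreover have "(\<sigma> * \<delta>)\<^sup>2 > 0" using sigma delta by simp
  ultimately have e0: "e > 0" unfolding e_def using C20 by (intro divide_pos_pos mult_pos_pos) auto
  have ND: "\<exists>D\<ge>e. (N has_real_derivative D) (at x)" if x: "x \<ge> 1" and dx: "d x < 0" for x
    unfolding e_def N_def
    by (rule lyapunov_deriv[OF A0 _ dx sR[OF x] k_def c_def \<epsilon>_def C2_def]) (use x in simp)
  have contN: "continuous_on {a..b} (\<lambda>x. N x - e * x)" if "a \<ge> 1" for a b
  proof -
    have "continuous_on {a..b} s" "continuous_on {a..b} d"
      using isCont_s[OF A0] isCont_d[OF A0] that by (auto intro!: continuous_at_imp_continuous_on)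
    moreover have "d x - 3 / 2 * \<delta> > 0" if "x \<in> {a..b}" for x
      using d_lower[OF A0, of x] that \<open>a \<ge> 1\<close> by simp
    then have "\<forall>x\<in>{a..b}. d x - 3 / 2 * \<delta> \<noteq> 0" "\<forall>x\<in>{a..b}. d x - 3 / 2 * \<delta> > 0" by force+
    moreover have "continuous_on {a..b} A" "continuous_on {a..b} B"
      using that by (auto intro: cont_A cont_B)
    ultimately show ?thesis unfolding N_def J_def \<psi>_def
      by (intro continuous_intros continuous_on_ln) auto
  qed
  have NDe: "\<exists>D\<ge>0. ((\<lambda>x. N x - e * x) has_real_derivative D) (at x)" if x: "x \<ge> 1" and dx: "d x < 0" for x
  proof -
    obtain D where D: "D \<ge> e" "(N has_real_derivative D) (at x)" using ND[OF x dx] by blast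
    have "((\<lambda>x. N x - e * x) has_real_derivative D - e * 1) (at x)"
      by (intro DERIV_diff D DERIV_cmult DERIV_ident)
    then show ?thesis using D(1) by (intro exI[of _ "D - e * 1"]) simp
  qed
  have Ngrow: "N 1 - e * 1 \<le> N y - e * y" if y: "y \<ge> 1" for y
  proof (rule local_right_mono[OF y contN])
    fix x \<eta> :: real assume x: "1 \<le> x" "x < y" "0 < \<eta>"
    obtain r where r: "r > x" "\<And>w. x < w \<Longrightarrow> w < r \<Longrightarrow> d w < 0"
    proof (cases "d x < 0")
      case True
      have "\<forall>\<^sub>F w in at_right x. d w < 0" using d_right[of x] x True by (intro order_tendstoD) auto
      then show ?thesis using that by (auto simp: eventually_at_right_field)
    next
      case False
      then have z: "d x = 0" "A x = 0" using lower_half_plane[OF A0, of x] x A_eq[of x] by auto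
      then have "\<forall>\<^sub>F w in at_right x. A w < 0" using A_neg_right_after[of x] x by simp
      then obtain r where r: "r > x" "\<And>w. x < w \<Longrightarrow> w < r \<Longrightarrow> A w < 0"
        by (auto simp: eventually_at_right_field)
      have "d w < 0" if "x < w" "w < r" for w
        using r(2)[OF that] A_eq[of w] lower_half_plane[OF A0, of w] that x by force
      then show ?thesis using that r(1) by blast
    qed
    have "N w - e * w \<ge> N x - e * x - \<eta> * (w - x)" if w: "x < w" "w < r" for w
    proof -
      have "N x - e * x \<le> N w - e * w"
      proof (rule DERIV_nonneg_imp_increasing_open[where f="\<lambda>x. N x - e * x"])
        show "\<exists>D. ((\<lambda>x. N x - e * x) has_real_derivative D) (at v) \<and> 0 \<le> D" if "x < v" "v < w" for v
          using NDe[of v] r(2)[of v] that x w by auto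
      qed (use w x contN[of x w] in auto)
      moreover have "\<eta> * (w - x) \<ge> 0" using w x by simp
      ultimately show ?thesis by linarith
    qed
    then show "\<forall>\<^sub>F w in at_right x. N w - e * w \<ge> N x - e * x - \<eta> * (w - x)"
      using r(1) by (auto simp: eventually_at_right_field)
  qed simp
  define K where "K = (R\<^sup>2 + 3 / 4 * \<delta>\<^sup>2) / (- \<delta> / 4) + 3 * \<delta>\<^sup>2 + - 4 * \<sigma> / \<delta>\<^sup>2 * (R * (- 2 * \<delta>))
    + \<epsilon> * (C2 * ((R - \<sigma>)\<^sup>2 + \<delta>\<^sup>2))"
  \<comment> \<open>From this time on the linear growth from \<open>N 1\<close> has exceeded the
    bound \<open>K\<close>.\<close>
  define X where "X = 1 + (\<bar>K - N 1\<bar> + 1) / e"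
  have X: "X \<ge> 1" using e0 by (simp add: X_def)
  have "d x \<le> 5 / 4 * \<delta>" if x: "X \<le> x" for x
  proof (rule ccontr)
    assume "\<not> d x \<le> 5 / 4 * \<delta>"
    then have dx: "5 / 4 * \<delta> \<le> d x" by simp
    have x1: "x \<ge> 1" using x X by simp
    have "J x \<le> (R\<^sup>2 + 3 / 4 * \<delta>\<^sup>2) / (- \<delta> / 4) + 3 * \<delta>\<^sup>2 + - 4 * \<sigma> / \<delta>\<^sup>2 * (R * (- 2 * \<delta>))"
      using x1 by (intro J_upper sR dx dle) auto
    moreover have "\<epsilon> * \<psi> x \<le> \<epsilon> * (C2 * ((R - \<sigma>)\<^sup>2 + \<delta>\<^sup>2))"
      unfolding C2_def using x1 \<epsilon>0 d_lower[OF A0, of x] by (intro mult_left_mono \<psi>_upper sR dle) auto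
    ultimately have "N x \<le> K" by (simp add: N_def K_def)
    moreover have "e * (x - 1) \<ge> \<bar>K - N 1\<bar> + 1"
      using x e0 by (simp add: X_def field_simps)
    moreover have "N 1 + e * (x - 1) \<le> N x" using Ngrow[OF x1] by (simp add: algebra_simps)
    ultimately show False by linarith
  qed
  then show False using d_not_below[OF A0, of X] X by simp
qed

end

section \<open>One-sided derivatives of admissible solutions\<close>

lemma derivative_straddle:
  fixes f :: "real \<Rightarrow> 'a::real_normed_vector"
  assumes D: "(f has_vector_derivative D) (at x)" "norm (D - p) \<le> e" and \<eta>: "\<eta> > 0"
  shows "\<exists>r>0. \<forall>u v. u \<le> x \<and> x \<le> v \<and> {u..v} \<subseteq> ball x r \<longrightarrow>
    norm ((f v - v *\<^sub>R p) - (f u - u *\<^sub>R p)) \<le> (e + \<eta>) * (v - u)"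
proof -
  obtain r where r: "r > 0" "\<And>w. norm (w - x) < r \<Longrightarrow>
      norm (f w - f x - (w - x) *\<^sub>R D) \<le> \<eta> * norm (w - x)"
    using D(1) \<eta> unfolding has_vector_derivative_def has_derivative_at_alt by metis
  have "norm ((f v - v *\<^sub>R p) - (f u - u *\<^sub>R p)) \<le> (e + \<eta>) * (v - u)"
    if uv: "u \<le> x" "x \<le> v" "{u..v} \<subseteq> ball x r" for u v
  proof -
    have "u \<in> ball x r" "v \<in> ball x r" using uv(1,2) subsetD[OF uv(3)] by auto
    then have close: "norm (u - x) < r" "norm (v - x) < r" by (auto simp: dist_real_def)
    \<comment> \<open>Because \<open>x\<close> lies between \<open>u\<close> and \<open>v\<close>,
      the errors on the two sides add up to a multiple of \<open>v - u\<close>.\<close>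
    have "(f v - v *\<^sub>R p) - (f u - u *\<^sub>R p) = (f v - f x - (v - x) *\<^sub>R D)
        - (f u - f x - (u - x) *\<^sub>R D) + (v - u) *\<^sub>R (D - p)"
      by (simp add: algebra_simps)
    also have "norm \<dots> \<le> norm (f v - f x - (v - x) *\<^sub>R D) + norm (f u - f x - (u - x) *\<^sub>R D)
        + norm ((v - u) *\<^sub>R (D - p))"
      by (rule order_trans[OF norm_triangle_ineq add_right_mono[OF norm_triangle_ineq4]])
    also have "\<dots> \<le> \<eta> * (v - x) + \<eta> * (x - u) + (v - u) * e"
    proof (intro add_mono)
      show "norm (f v - f x - (v - x) *\<^sub>R D) \<le> \<eta> * (v - x)" using r(2)[OF close(2)] uv by simp
      show "norm (f u - f x - (u - x) *\<^sub>R D) \<le> \<eta> * (x - u)" using r(2)[OF close(1)] uv by simp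
      show "norm ((v - u) *\<^sub>R (D - p)) \<le> (v - u) * e" using uv D(2) by (simp add: mult_left_mono)
    qed
    also have "\<dots> = (e + \<eta>) * (v - u)" by (simp add: algebra_simps)
    finally show ?thesis .
  qed
  then show ?thesis using r(1) by blast
qed

text \<open>A Henstock-type gauge argument replaces integration of the derivative. At good tags the
  derivative controls the increment; at tags in the null set the gauge forces the interval into an
  open set of small measure, where absolute continuity controls the total increment.\<close>

lemma abs_continuous_mean_value:
  fixes f :: "real \<Rightarrow> 'a::real_normed_vector"
  assumes ab: "a \<le> b" and ac: "abs_continuous_on {a..b} f"
    and neg: "negligible N"
    and D: "\<And>x. x \<in> {a..b} - N \<Longrightarrow> \<exists>D. (f has_vector_derivative D) (at x) \<and> norm (D - p) \<le> e"
    and e: "0 \<le> e"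
  shows "norm ((f b - b *\<^sub>R p) - (f a - a *\<^sub>R p)) \<le> e * (b - a)"
proof (rule field_le_epsilon)
  fix \<epsilon> :: real assume \<epsilon>: "\<epsilon> > 0"
  \<comment> \<open>The good intervals contribute an error \<open>\<eta> * (b - a)\<close>, the bad
    ones \<open>2 * \<eta>\<close>.\<close>
  define \<eta> where "\<eta> = \<epsilon> / (b - a + 2)"
  have \<eta>: "\<eta> > 0" using \<epsilon> ab by (simp add: \<eta>_def)
  define g where "g x = f x - x *\<^sub>R p" for x
  from ac[unfolded abs_continuous_on_def, THEN spec, THEN mp, OF \<eta>]
  obtain \<delta>0 where \<delta>0: "\<delta>0 > 0"
    and ac': "\<forall>P :: (real \<times> real) set. finite P \<and> (\<forall>(s, t)\<in>P. s < t \<and> {s..t} \<subseteq> {a..b}) \<and>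
        disjoint_family_on (\<lambda>(s, t). {s<..<t}) P \<and> (\<Sum>(s, t)\<in>P. t - s) < \<delta>0
        \<longrightarrow> (\<Sum>(s, t)\<in>P. norm (f t - f s)) < \<eta>"
    by (elim exE conjE)
  \<comment> \<open>The second entry keeps the linear part \<open>x *\<^sub>R p\<close> below \<eta>
    on the bad intervals.\<close>
  define \<delta> where "\<delta> = min \<delta>0 (\<eta> / (1 + norm p))"
  have np: "1 + norm p > 0" by (simp add: add_pos_nonneg)
  have \<delta>: "\<delta> > 0" using \<delta>0 \<eta> np by (simp add: \<delta>_def)
  have Nnull: "N \<in> null_sets lebesgue" using neg by (simp add: negligible_iff_null_sets)
  then obtain T where T: "open T" "N \<subseteq> T" "T - N \<in> lmeasurable" "emeasure lebesgue (T - N) < ennreal \<delta>"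
    using sets_lebesgue_outer_open[OF _ \<delta>, of N] by blast
  have "(T - N) \<union> N \<in> lmeasurable"
    using T(3) negligible_imp_measurable[OF neg] by (rule fmeasurable.Un)
  moreover have "(T - N) \<union> N = T" using T(2) by blast
  ultimately have Tmeas: "T \<in> lmeasurable" by simp
  have "measure lebesgue (T - N) < \<delta>"
    using T(4) emeasure_eq_measure2[OF T(3)] by (simp add: ennreal_less_iff)
  then have Tsmall: "measure lebesgue T < \<delta>"
    using measure_Diff_null_set[OF fmeasurableD[OF Tmeas] Nnull] by simp
  have "\<exists>r>0. x \<in> {a..b} - N \<longrightarrow> (\<forall>u v. u \<le> x \<and> x \<le> v \<and> {u..v} \<subseteq> ball x r \<longrightarrow>
    norm (g v - g u) \<le> (e + \<eta>) * (v - u))" for x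
  proof (cases "x \<in> {a..b} - N")
    case True
    then obtain D where "(f has_vector_derivative D) (at x)" "norm (D - p) \<le> e" using D by blast
    from derivative_straddle[OF this \<eta>] show ?thesis by (simp add: g_def) blast
  qed (auto intro: exI[of _ 1])
  then obtain r where r: "\<And>x. r x > 0" "\<And>x u v. x \<in> {a..b} - N \<Longrightarrow> u \<le> x \<Longrightarrow> x \<le> v \<Longrightarrow>
      {u..v} \<subseteq> ball x (r x) \<Longrightarrow> norm (g v - g u) \<le> (e + \<eta>) * (v - u)"
    by metis
  define \<gamma> where "\<gamma> x = (if x \<in> N then T else ball x (r x))" for x
  have "gauge \<gamma>" using T r(1) by (auto simp: gauge_def \<gamma>_def)
  then obtain q where q: "q tagged_division_of {a..b}" "\<gamma> fine q" by (rule fine_division_exists_real)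
  have fin: "finite q" using q(1) by (rule tagged_division_ofD)
  have K: "\<exists>u v. K = {u..v} \<and> u \<le> x \<and> x \<le> v \<and> {u..v} \<subseteq> {a..b} \<and> {u..v} \<subseteq> \<gamma> x"
    if xK: "(x, K) \<in> q" for x K
  proof -
    obtain u v where uv: "K = cbox u v" using tagged_division_ofD(4)[OF q(1) xK] by blast
    then have "u \<le> x" "x \<le> v" using tagged_division_ofD(2)[OF q(1) xK] by auto
    moreover have "{u..v} \<subseteq> {a..b}" "{u..v} \<subseteq> \<gamma> x"
      using tagged_division_ofD(3)[OF q(1) xK] q(2) xK uv by (auto simp: fine_def)
    ultimately show ?thesis using uv by auto
  qed
  \<comment> \<open>One-point intervals are left out: they contribute nothing, absolute continuity
    speaks of \<open>s < t\<close>, and only intervals with interior are determined to be distinct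
    by disjointness.\<close>
  define bad where "bad = {(x, K). (x, K) \<in> q \<and> x \<in> N \<and> Inf K < Sup K}"
  have badq: "bad \<subseteq> q" by (auto simp: bad_def)
  have bad_tpd: "bad tagged_partial_division_of {a..b}"
    by (rule tagged_partial_division_subset[OF _ badq]) (use q(1) in \<open>simp add: tagged_division_of_def\<close>)
  have badK: "\<exists>u v. K = {u..v} \<and> u < v \<and> {u..v} \<subseteq> {a..b} \<and> {u..v} \<subseteq> T" if xK: "(x, K) \<in> bad" for x K
  proof -
    obtain u v where uv: "K = {u..v}" "u \<le> x" "x \<le> v" "{u..v} \<subseteq> {a..b}" "{u..v} \<subseteq> \<gamma> x"
      using K[of x K] xK badq by blast
    then have "u < v" "x \<in> N" using xK by (auto simp: bad_def)
    then show ?thesis using uv by (auto simp: \<gamma>_def)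
  qed
  have disj: "interior K1 \<inter> interior K2 = {}" if "(x1, K1) \<in> bad" "(x2, K2) \<in> bad" "(x1, K1) \<noteq> (x2, K2)" for x1 K1 x2 K2
    using tagged_partial_division_ofD(5)[OF bad_tpd] that by blast
  have inj: "inj_on snd bad"
  proof (rule inj_onI)
    fix z w assume "z \<in> bad" "w \<in> bad" "snd z = snd w"
    then obtain x y K where zw: "z = (x, K)" "w = (y, K)" "(x, K) \<in> bad" "(y, K) \<in> bad"
      by (metis prod.collapse)
    then obtain u v where "K = {u..v}" "u < v" using badK by blast
    then have "interior K \<noteq> {}" by simp
    then show "z = w" using disj[OF zw(3,4)] zw(1,2) by auto
  qed
  define ends :: "real \<times> real set \<Rightarrow> real \<times> real" where "ends z = (Inf (snd z), Sup (snd z))" for z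
  have inj_ends: "inj_on ends bad"
  proof (rule inj_onI)
    fix z w assume zw: "z \<in> bad" "w \<in> bad" "ends z = ends w"
    obtain u v u' v' where "snd z = {u..v}" "u < v" "snd w = {u'..v'}" "u' < v'"
      using badK[of "fst z" "snd z"] badK[of "fst w" "snd w"] zw by auto
    then have "snd z = snd w" using zw by (simp add: ends_def)
    then show "z = w" using inj zw by (auto dest: inj_onD)
  qed
  have finbad: "finite bad" using fin badq by (rule rev_finite_subset)
  have sum_ends: "(\<Sum>(s, t)\<in>ends ` bad. h s t) = (\<Sum>(x, K)\<in>bad. h (Inf K) (Sup K))" for h :: "real \<Rightarrow> real \<Rightarrow> real"
    by (subst sum.reindex[OF inj_ends]) (simp add: ends_def case_prod_beta)
  have len: "(\<Sum>(x, K)\<in>bad. Sup K - Inf K) < \<delta>"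
  proof -
    have "(\<Sum>(x, K)\<in>bad. Sup K - Inf K) = (\<Sum>z\<in>bad. measure lebesgue (snd z))"
    proof (rule sum.cong[OF refl])
      fix z assume z: "z \<in> bad"
      then obtain u v where "snd z = {u..v}" "u < v" using badK[of "fst z" "snd z"] by auto
      then show "(case z of (x, K) \<Rightarrow> Sup K - Inf K) = measure lebesgue (snd z)"
        by (simp add: case_prod_beta)
    qed
    also have "\<dots> = (\<Sum>K\<in>snd ` bad. measure lebesgue K)" by (simp add: sum.reindex[OF inj])
    also have "\<dots> = measure lebesgue (\<Union>(snd ` bad))"
      by (rule content_division[OF partial_division_of_tagged_division[OF bad_tpd]])
    also have "\<dots> \<le> measure lebesgue T"
    proof (rule measure_mono_fmeasurable)
      show "\<Union>(snd ` bad) \<subseteq> T" using badK by fastforce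
      show "\<Union>(snd ` bad) \<in> sets lebesgue"
        using finbad badK by (intro sets.finite_Union) force+
      show "T \<in> lmeasurable" by (rule Tmeas)
    qed
    finally show ?thesis using Tsmall by simp
  qed
  have fbad: "(\<Sum>(x, K)\<in>bad. norm (f (Sup K) - f (Inf K))) < \<eta>"
  proof -
    have "(\<Sum>(s, t)\<in>ends ` bad. norm (f t - f s)) < \<eta>"
    proof (rule ac'[THEN spec, THEN mp], intro conjI)
      show "finite (ends ` bad)" using finbad by simp
      show "\<forall>(s, t)\<in>ends ` bad. s < t \<and> {s..t} \<subseteq> {a..b}"
        using badK by (fastforce simp: ends_def)
      show "disjoint_family_on (\<lambda>(s, t). {s<..<t}) (ends ` bad)"
        unfolding disjoint_family_on_def
      proof (intro ballI impI)
        fix m n assume mn: "m \<in> ends ` bad" "n \<in> ends ` bad" "m \<noteq> n"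
        then obtain x K y M where *: "(x, K) \<in> bad" "(y, M) \<in> bad" "m = ends (x, K)" "n = ends (y, M)"
          by auto
        obtain u v u' v' where "K = {u..v}" "u < v" "M = {u'..v'}" "u' < v'"
          using badK[OF *(1)] badK[OF *(2)] by blast
        moreover have "interior K \<inter> interior M = {}"
          using disj[OF *(1,2)] *(3,4) mn(3) by auto
        ultimately show "(case m of (s, t) \<Rightarrow> {s<..<t}) \<inter> (case n of (s, t) \<Rightarrow> {s<..<t}) = {}"
          using *(3,4) by (simp add: ends_def)
      qed
      show "(\<Sum>(s, t)\<in>ends ` bad. t - s) < \<delta>0"
        using len sum_ends[of "\<lambda>s t. t - s"] by (simp add: \<delta>_def)
    qed
    then show ?thesis using sum_ends[of "\<lambda>s t. norm (f t - f s)"] by simp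
  qed
  have "g b - g a = (\<Sum>(x, K)\<in>q. g (Sup K) - g (Inf K))"
    using additive_tagged_division_1[OF ab q(1), of g] by simp
  also have "norm \<dots> \<le> (\<Sum>z\<in>q. norm (case z of (x, K) \<Rightarrow> g (Sup K) - g (Inf K)))" by (rule norm_sum)
  also have "\<dots> = (\<Sum>z\<in>q - bad. norm (case z of (x, K) \<Rightarrow> g (Sup K) - g (Inf K)))
      + (\<Sum>z\<in>bad. norm (case z of (x, K) \<Rightarrow> g (Sup K) - g (Inf K)))"
    by (rule sum.subset_diff[OF badq fin])
  also have "\<dots> \<le> (e + \<eta>) * (b - a) + 2 * \<eta>"
  proof (rule add_mono)
    have "(\<Sum>z\<in>q - bad. norm (case z of (x, K) \<Rightarrow> g (Sup K) - g (Inf K)))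
        \<le> (\<Sum>z\<in>q - bad. (e + \<eta>) * (case z of (x, K) \<Rightarrow> Sup K - Inf K))"
    proof (rule sum_mono)
      fix z assume z: "z \<in> q - bad"
      obtain x K where zxK: "z = (x, K)" by fastforce
      obtain u v where uv: "K = {u..v}" "u \<le> x" "x \<le> v" "{u..v} \<subseteq> {a..b}" "{u..v} \<subseteq> \<gamma> x"
        using K[of x K] z zxK by blast
      then have uv': "u \<le> v" by simp
      show "norm (case z of (x, K) \<Rightarrow> g (Sup K) - g (Inf K)) \<le> (e + \<eta>) * (case z of (x, K) \<Rightarrow> Sup K - Inf K)"
      proof (cases "x \<in> N")
        case True
        then have "\<not> u < v" using z zxK uv by (auto simp: bad_def)
        then show ?thesis using uv uv' zxK by simp
      next
        case False
        then have "x \<in> {a..b} - N" "{u..v} \<subseteq> ball x (r x)" using uv by (auto simp: \<gamma>_def)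
        then show ?thesis using r(2)[of x u v] uv uv' zxK by simp
      qed
    qed
    also have "\<dots> = (e + \<eta>) * (\<Sum>z\<in>q - bad. case z of (x, K) \<Rightarrow> Sup K - Inf K)"
      by (simp add: sum_distrib_left)
    also have "\<dots> \<le> (e + \<eta>) * (\<Sum>z\<in>q. case z of (x, K) \<Rightarrow> Sup K - Inf K)"
    proof (intro mult_left_mono sum_mono2 fin)
      fix z assume "z \<in> q - (q - bad)"
      then show "0 \<le> (case z of (x, K) \<Rightarrow> Sup K - Inf K)" by (auto simp: bad_def)
    qed (use e \<eta> in auto)
    also have "\<dots> = (e + \<eta>) * (b - a)"
      using additive_tagged_division_1[OF ab q(1), of "\<lambda>x. x"] by simp
    finally show "(\<Sum>z\<in>q - bad. norm (case z of (x, K) \<Rightarrow> g (Sup K) - g (Inf K))) \<le> (e + \<eta>) * (b - a)" .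
    have "(\<Sum>z\<in>bad. norm (case z of (x, K) \<Rightarrow> g (Sup K) - g (Inf K)))
       \<le> (\<Sum>z\<in>bad. (case z of (x, K) \<Rightarrow> norm (f (Sup K) - f (Inf K))) + norm p * (case z of (x, K) \<Rightarrow> Sup K - Inf K))"
    proof (rule sum_mono)
      fix z assume z: "z \<in> bad"
      obtain x K where zxK: "z = (x, K)" by fastforce
      have "g (Sup K) - g (Inf K) = (f (Sup K) - f (Inf K)) - (Sup K - Inf K) *\<^sub>R p"
        by (simp add: g_def algebra_simps)
      also have "norm \<dots> \<le> norm (f (Sup K) - f (Inf K)) + norm ((Sup K - Inf K) *\<^sub>R p)" by (rule norm_triangle_ineq4)
      also have "norm ((Sup K - Inf K) *\<^sub>R p) = norm p * (Sup K - Inf K)"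
        using z zxK by (simp add: bad_def)
      finally show "norm (case z of (x, K) \<Rightarrow> g (Sup K) - g (Inf K)) \<le>
          (case z of (x, K) \<Rightarrow> norm (f (Sup K) - f (Inf K))) + norm p * (case z of (x, K) \<Rightarrow> Sup K - Inf K)"
        by (simp add: zxK)
    qed
    also have "\<dots> = (\<Sum>(x, K)\<in>bad. norm (f (Sup K) - f (Inf K))) + norm p * (\<Sum>(x, K)\<in>bad. Sup K - Inf K)"
      by (simp add: sum.distrib sum_distrib_left)
    also have "\<dots> \<le> \<eta> + norm p * \<delta>" using fbad len by (intro add_mono mult_left_mono) auto
    also have "norm p * \<delta> \<le> norm p * (\<eta> / (1 + norm p))" by (intro mult_left_mono) (auto simp: \<delta>_def)
    also have "\<dots> \<le> \<eta>" using \<eta> np by (simp add: field_simps)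
    finally show "(\<Sum>z\<in>bad. norm (case z of (x, K) \<Rightarrow> g (Sup K) - g (Inf K))) \<le> 2 * \<eta>" by simp
  qed
  also have "\<dots> = e * (b - a) + \<eta> * (b - a + 2)" by (simp add: algebra_simps)
  also have "\<eta> * (b - a + 2) = \<epsilon>" using ab by (simp add: \<eta>_def)
  finally show "norm ((f b - b *\<^sub>R p) - (f a - a *\<^sub>R p)) \<le> e * (b - a) + \<epsilon>" by (simp add: g_def)
qed

section \<open>One-sided limits along a set of full measure\<close>

lemma negligible_complement_dense:
  fixes a b :: real
  assumes "negligible N" "a < b"
  obtains x where "a < x" "x < b" "x \<notin> N"
proof -
  have "\<not> negligible (box a b)" using assms(2) unfolding negligible_interval by (auto simp: box_eq_empty)
  then have "\<not> box a b \<subseteq> N" using negligible_subset[OF assms(1)] by blast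
  then obtain x where "x \<in> box a b" "x \<notin> N" by blast
  then show ?thesis using that[of x] by (simp add: mem_box)
qed

lemma at_within_right_nontrivial:
  fixes y :: real
  assumes "negligible N" "- N \<subseteq> S"
  shows "at y within (S \<inter> {y<..}) \<noteq> bot"
proof -
  have "\<exists>x\<in>S \<inter> {y<..}. x \<noteq> y \<and> dist x y < e" if e: "e > 0" for e
  proof -
    obtain x where x: "y < x" "x < y + e" "x \<notin> N"
      using negligible_complement_dense[OF assms(1), of y "y + e"] e by auto
    then have "x \<in> S \<inter> {y<..}" using assms(2) by auto
    then show ?thesis using x by (intro bexI[of _ x]) (auto simp: dist_real_def)
  qed
  then show ?thesis by (simp add: trivial_limit_within islimpt_approachable)
qed

lemma at_within_left_nontrivial:
  fixes y :: real
  assumes "negligible N" "- N \<subseteq> S"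
  shows "at y within (S \<inter> {..<y}) \<noteq> bot"
proof -
  have "\<exists>x\<in>S \<inter> {..<y}. x \<noteq> y \<and> dist x y < e" if e: "e > 0" for e
  proof -
    obtain x where x: "y - e < x" "x < y" "x \<notin> N"
      using negligible_complement_dense[OF assms(1), of "y - e" y] e by auto
    then have "x \<in> S \<inter> {..<y}" using assms(2) by auto
    then show ?thesis using x by (intro bexI[of _ x]) (auto simp: dist_real_def)
  qed
  then show ?thesis by (simp add: trivial_limit_within islimpt_approachable)
qed

lemma tendsto_at_right_within_dist:
  fixes f :: "real \<Rightarrow> 'a::metric_space"
  assumes "(f \<longlongrightarrow> p) (at y within (D \<inter> {y<..}))" "e > 0"
  obtains r where "r > 0" "\<And>x. x \<in> D \<Longrightarrow> y < x \<Longrightarrow> x < y + r \<Longrightarrow> dist (f x) p < e"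
proof -
  obtain r where "r > 0" "\<forall>x\<in>D \<inter> {y<..}. x \<noteq> y \<and> dist x y < r \<longrightarrow> dist (f x) p < e"
    using tendstoD[OF assms] unfolding eventually_at by blast
  then show ?thesis using that[of r] by (auto simp: dist_real_def)
qed

lemma tendsto_at_left_within_dist:
  fixes f :: "real \<Rightarrow> 'a::metric_space"
  assumes "(f \<longlongrightarrow> p) (at y within (D \<inter> {..<y}))" "e > 0"
  obtains r where "r > 0" "\<And>x. x \<in> D \<Longrightarrow> y - r < x \<Longrightarrow> x < y \<Longrightarrow> dist (f x) p < e"
proof -
  obtain r where "r > 0" "\<forall>x\<in>D \<inter> {..<y}. x \<noteq> y \<and> dist x y < r \<longrightarrow> dist (f x) p < e"
    using tendstoD[OF assms] unfolding eventually_at by blast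
  then show ?thesis using that[of r] by (auto simp: dist_real_def)
qed

section \<open>The quadratic map and the pointwise form of admissibility\<close>

definition \<Phi>1 :: "real \<times> real \<Rightarrow> real" where "\<Phi>1 p = fst p * snd p + (fst p)\<^sup>2 / 2"
definition \<Phi>2 :: "real \<times> real \<Rightarrow> real" where "\<Phi>2 p = fst p * snd p + (snd p)\<^sup>2 / 2"

text \<open>In the coordinate \<open>z\<close> the map \<open>(\<Phi>1, \<Phi>2)\<close> is complex squaring up to a linear change of variables.\<close>
lemma \<Phi>_eq_imp:
  assumes "\<Phi>1 p = \<Phi>1 q" "\<Phi>2 p = \<Phi>2 q"
  shows "p = q \<or> p = - q"
proof -
  define s d s' d' where "s = fst p + snd p" and "d = fst p - snd p"
    and "s' = fst q + snd q" and "d' = fst q - snd q"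
  have 1: "s * d = s' * d'" and 2: "3 * s\<^sup>2 - d\<^sup>2 = 3 * s'\<^sup>2 - d'\<^sup>2"
    using assms unfolding \<Phi>1_def \<Phi>2_def s_def d_def s'_def d'_def by (simp_all add: power2_eq_square algebra_simps)
  have "(3 * s\<^sup>2 + d\<^sup>2)\<^sup>2 = (3 * s'\<^sup>2 + d'\<^sup>2)\<^sup>2"
  proof -
    have "(3 * s\<^sup>2 + d\<^sup>2)\<^sup>2 = (3 * s\<^sup>2 - d\<^sup>2)\<^sup>2 + 12 * (s * d)\<^sup>2" by algebra
    also have "\<dots> = (3 * s'\<^sup>2 - d'\<^sup>2)\<^sup>2 + 12 * (s' * d')\<^sup>2" using 1 2 by simp
    also have "\<dots> = (3 * s'\<^sup>2 + d'\<^sup>2)\<^sup>2" by algebra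
    finally show ?thesis .
  qed
  then have 3: "3 * s\<^sup>2 + d\<^sup>2 = 3 * s'\<^sup>2 + d'\<^sup>2" by (rule power2_eq_imp_eq) auto
  have sd: "s\<^sup>2 = s'\<^sup>2" "d\<^sup>2 = d'\<^sup>2" using 2 3 by linarith+
  have "s = s' \<and> d = d' \<or> s = - s' \<and> d = - d'"
    using sd 1 by (auto simp: power2_eq_iff)
  then show ?thesis
    unfolding s_def d_def s'_def d'_def by (auto simp: prod_eq_iff)
qed

lemma admissible_null_set:
  assumes "admissible_solution h1 h2 u"
  obtains N where "negligible N" "- N \<subseteq> diff_points u"
    "\<And>x. x \<notin> N \<Longrightarrow> fst (u x) = h1 x - \<Phi>1 (du u x)" "\<And>x. x \<notin> N \<Longrightarrow> snd (u x) = h2 x - \<Phi>2 (du u x)"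
proof -
  have "AE x in lebesgue. satisfies_system_at h1 h2 u x"
    using assms by (simp add: admissible_solution_def)
  then obtain N where N: "N \<in> null_sets lebesgue" "{x. \<not> satisfies_system_at h1 h2 u x} \<subseteq> N"
    by (auto simp: eventually_ae_filter)
  then have sat: "satisfies_system_at h1 h2 u x" if "x \<notin> N" for x using that by blast
  show ?thesis
  proof (rule that)
    show "negligible N" using N(1) by (simp add: negligible_iff_null_sets)
    show "- N \<subseteq> diff_points u" using sat by (auto simp: satisfies_system_at_def)
    show "fst (u x) = h1 x - \<Phi>1 (du u x)" "snd (u x) = h2 x - \<Phi>2 (du u x)" if "x \<notin> N" for x
      using sat[OF that] by (simp_all add: satisfies_system_at_def \<Phi>1_def \<Phi>2_def)
  qed
qed

lemma admissible_mean_value: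
  assumes adm: "admissible_solution h1 h2 u" and ab: "a \<le> b" and e: "0 \<le> e"
    and close: "\<And>x. x \<in> diff_points u \<Longrightarrow> a < x \<Longrightarrow> x < b \<Longrightarrow> norm (du u x - p) \<le> e"
  shows "norm ((u b - b *\<^sub>R p) - (u a - a *\<^sub>R p)) \<le> e * (b - a)"
proof -
  obtain N where N: "negligible N" "- N \<subseteq> diff_points u" using admissible_null_set[OF adm] by metis
  show ?thesis
  \<comment> \<open>The end points join the null set because closeness to \<open>p\<close> is known
    only inside the interval.\<close>
  proof (rule abs_continuous_mean_value[OF ab _ _ _ e, where N="N \<union> {a, b}"])
    show "abs_continuous_on {a..b} u" using adm by (simp add: admissible_solution_def)
    show "negligible (N \<union> {a, b})" using N(1) by (simp add: negligible_Un negligible_finite)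
    fix x assume x: "x \<in> {a..b} - (N \<union> {a, b})"
    then have "x \<in> diff_points u" using N(2) by blast
    moreover from this have "(u has_vector_derivative du u x) (at x)"
      by (simp add: diff_points_def du_def vector_derivative_works[symmetric])
    ultimately show "\<exists>D. (u has_vector_derivative D) (at x) \<and> norm (D - p) \<le> e"
      using close x by (intro exI[of _ "du u x"]) auto
  qed
qed

text \<open>Near \<open>y\<close> on the right \<open>du u\<close> is almost everywhere close to
  \<open>p\<close>, so the mean value inequality turns the limit of derivatives into a one-sided
  derivative.\<close>

lemma admissible_right_derivative:
  assumes adm: "admissible_solution h1 h2 u" and lim: "du_right_limit u y p"
  shows "(u has_vector_derivative p) (at_right y)"
  unfolding has_vector_derivative_def has_derivative_within_alt
proof (intro conjI allI impI)
  show "bounded_linear (\<lambda>x. x *\<^sub>R p)" by (rule bounded_linear_scaleR_left)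
  fix e :: real assume e: "e > 0"
  then obtain r where r: "r > 0" "\<And>x. x \<in> diff_points u \<Longrightarrow> y < x \<Longrightarrow> x < y + r \<Longrightarrow> dist (du u x) p < e"
    using tendsto_at_right_within_dist[OF lim[unfolded du_right_limit_def]] by blast
  have "norm (u v - u y - (v - y) *\<^sub>R p) \<le> e * norm (v - y)" if v: "v \<in> {y<..}" "norm (v - y) < r" for v
  proof -
    have "norm ((u v - v *\<^sub>R p) - (u y - y *\<^sub>R p)) \<le> e * (v - y)"
      by (rule admissible_mean_value[OF adm]) (use e v r(2) in \<open>auto simp: dist_norm intro!: less_imp_le\<close>)
    then show ?thesis using v by (simp add: algebra_simps)
  qed
  then show "\<exists>d>0. \<forall>v\<in>{y<..}. norm (v - y) < d \<longrightarrow> norm (u v - u y - (v - y) *\<^sub>R p) \<le> e * norm (v - y)"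
    using r(1) by blast
qed

lemma admissible_left_derivative:
  assumes adm: "admissible_solution h1 h2 u" and lim: "du_left_limit u y p"
  shows "(u has_vector_derivative p) (at_left y)"
  unfolding has_vector_derivative_def has_derivative_within_alt
proof (intro conjI allI impI)
  show "bounded_linear (\<lambda>x. x *\<^sub>R p)" by (rule bounded_linear_scaleR_left)
  fix e :: real assume e: "e > 0"
  then obtain r where r: "r > 0" "\<And>x. x \<in> diff_points u \<Longrightarrow> y - r < x \<Longrightarrow> x < y \<Longrightarrow> dist (du u x) p < e"
    using tendsto_at_left_within_dist[OF lim[unfolded du_left_limit_def]] by blast
  have "norm (u v - u y - (v - y) *\<^sub>R p) \<le> e * norm (v - y)" if v: "v \<in> {..<y}" "norm (v - y) < r" for v
  proof -
    have "norm ((u y - y *\<^sub>R p) - (u v - v *\<^sub>R p)) \<le> e * (y - v)"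
      by (rule admissible_mean_value[OF adm]) (use e v r(2) in \<open>auto simp: dist_norm intro!: less_imp_le\<close>)
    moreover have "(u y - y *\<^sub>R p) - (u v - v *\<^sub>R p) = - (u v - u y - (v - y) *\<^sub>R p)" by (simp add: algebra_simps)
    ultimately show ?thesis using v by (simp add: norm_minus_commute)
  qed
  then show "\<exists>d>0. \<forall>v\<in>{..<y}. norm (v - y) < d \<longrightarrow> norm (u v - u y - (v - y) *\<^sub>R p) \<le> e * norm (v - y)"
    using r(1) by blast
qed

text \<open>Closeness on an open set passes to the one-sided limits at each of its points; this
  makes the functions of right and left limits have one-sided limits themselves.\<close>

lemma limit_in_cball:
  fixes f :: "real \<Rightarrow> 'a::metric_space"
  assumes lim: "(f \<longlongrightarrow> q) (at x within (D \<inter> S))" and nt: "at x within (D \<inter> S) \<noteq> bot"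
    and T: "open T" "x \<in> T" and close: "\<And>w. w \<in> D \<Longrightarrow> w \<in> T \<Longrightarrow> dist (f w) p < e"
  shows "dist q p \<le> e"
proof (rule tendsto_upperbound[OF _ _ nt])
  show "((\<lambda>w. dist (f w) p) \<longlongrightarrow> dist q p) (at x within (D \<inter> S))" by (intro tendsto_intros lim)
  have "\<forall>\<^sub>F w in at x within (D \<inter> S). w \<in> T" using T by (simp add: eventually_at_topological) blast
  moreover have "\<forall>\<^sub>F w in at x within (D \<inter> S). w \<in> D \<inter> S" by (simp add: eventually_at_filter)
  ultimately show "\<forall>\<^sub>F w in at x within (D \<inter> S). dist (f w) p \<le> e"
    by eventually_elim (use close in \<open>auto intro: less_imp_le\<close>)
qed

text \<open>Replaces a derivative known almost everywhere by its one-sided limits, which exist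
  everywhere. The system survives in the limit because it holds on a dense set and all its terms
  converge; the two limits then have the same image under the quadratic map.\<close>

lemma admissible_one_sided:
  assumes adm: "admissible_solution h1 h2 u"
    and h: "continuous_on UNIV h1" "continuous_on UNIV h2"
  obtains r l :: "real \<Rightarrow> real \<times> real"
  where "\<And>y. (u has_vector_derivative r y) (at_right y)" "\<And>y. (u has_vector_derivative l y) (at_left y)"
    "\<And>y. fst (u y) = h1 y - \<Phi>1 (r y)" "\<And>y. snd (u y) = h2 y - \<Phi>2 (r y)"
    "\<And>y. (r \<longlongrightarrow> r y) (at_right y)" "\<And>y. (l \<longlongrightarrow> r y) (at_right y)"
    "\<And>y. (r \<longlongrightarrow> l y) (at_left y)" "\<And>y. (l \<longlongrightarrow> l y) (at_left y)"
    "\<And>y. l y = r y \<or> l y = - r y \<and> fst (r y) + snd (r y) \<le> 0"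
proof -
  obtain r l where rl: "\<And>y. du_right_limit u y (r y)" "\<And>y. du_left_limit u y (l y)"
    and adm': "\<And>y. \<not> du_continuous_at u y \<Longrightarrow> fst (r y) + snd (r y) \<le> 0 \<or> fst (l y) + snd (l y) \<ge> 0"
    using adm unfolding admissible_solution_def by metis
  obtain N where N: "negligible N" "- N \<subseteq> diff_points u"
    "\<And>x. x \<notin> N \<Longrightarrow> fst (u x) = h1 x - \<Phi>1 (du u x)" "\<And>x. x \<notin> N \<Longrightarrow> snd (u x) = h2 x - \<Phi>2 (du u x)"
    using admissible_null_set[OF adm] by metis
  note ntr = at_within_right_nontrivial[OF N(1)] and ntl = at_within_left_nontrivial[OF N(1)]
  have right: "(u has_vector_derivative r y) (at_right y)" for y
    by (rule admissible_right_derivative[OF adm rl(1)])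
  have left: "(u has_vector_derivative l y) (at_left y)" for y
    by (rule admissible_left_derivative[OF adm rl(2)])
  have h_lim: "(h1 \<longlongrightarrow> h1 y) (at y within S)" "(h2 \<longlongrightarrow> h2 y) (at y within S)" for y S
    using h by (auto simp: continuous_on_eq_continuous_at isCont_def intro: tendsto_within_subset)
  have u_right: "(u \<longlongrightarrow> u y) (at y within (- N \<inter> {y<..}))" for y
    using has_vector_derivative_continuous[OF right[of y]]
    by (auto simp: continuous_within intro: tendsto_within_subset)
  have u_left: "(u \<longlongrightarrow> u y) (at y within (- N \<inter> {..<y}))" for y
    using has_vector_derivative_continuous[OF left[of y]]
    by (auto simp: continuous_within intro: tendsto_within_subset)
  have \<Phi>_lim: "fst (u y) = h1 y - \<Phi>1 p \<and> snd (u y) = h2 y - \<Phi>2 p"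
    if du: "(du u \<longlongrightarrow> p) (at y within (diff_points u \<inter> S))"
      and nt: "at y within (- N \<inter> S) \<noteq> bot" and ulim: "(u \<longlongrightarrow> u y) (at y within (- N \<inter> S))" for y p S
  proof -
    have du': "(du u \<longlongrightarrow> p) (at y within (- N \<inter> S))"
      by (rule tendsto_within_subset[OF du]) (use N(2) in blast)
    have mem: "\<forall>\<^sub>F x in at y within (- N \<inter> S). x \<notin> N" by (auto simp: eventually_at_filter)
    have "((\<lambda>x. h1 x - \<Phi>1 (du u x)) \<longlongrightarrow> h1 y - \<Phi>1 p) (at y within (- N \<inter> S))"
      unfolding \<Phi>1_def by (intro tendsto_intros h_lim du') auto
    moreover have "((\<lambda>x. h1 x - \<Phi>1 (du u x)) \<longlongrightarrow> fst (u y)) (at y within (- N \<inter> S))"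
      by (rule Lim_transform_eventually[OF tendsto_fst[OF ulim]])
        (use mem in \<open>eventually_elim, simp add: N(3)\<close>)
    moreover have "((\<lambda>x. h2 x - \<Phi>2 (du u x)) \<longlongrightarrow> h2 y - \<Phi>2 p) (at y within (- N \<inter> S))"
      unfolding \<Phi>2_def by (intro tendsto_intros h_lim du') auto
    moreover have "((\<lambda>x. h2 x - \<Phi>2 (du u x)) \<longlongrightarrow> snd (u y)) (at y within (- N \<inter> S))"
      by (rule Lim_transform_eventually[OF tendsto_snd[OF ulim]])
        (use mem in \<open>eventually_elim, simp add: N(4)\<close>)
    ultimately show ?thesis using tendsto_unique[OF nt] by blast
  qed
  have \<Phi>r: "fst (u y) = h1 y - \<Phi>1 (r y)" "snd (u y) = h2 y - \<Phi>2 (r y)" for y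
    using \<Phi>_lim[OF rl(1)[unfolded du_right_limit_def] ntr u_right] by auto
  have \<Phi>l: "fst (u y) = h1 y - \<Phi>1 (l y)" "snd (u y) = h2 y - \<Phi>2 (l y)" for y
    using \<Phi>_lim[OF rl(2)[unfolded du_left_limit_def] ntl u_left] by auto
  have close: "dist (r x) p \<le> e \<and> dist (l x) p \<le> e"
    if "open T" "x \<in> T" "\<And>w. w \<in> diff_points u \<Longrightarrow> w \<in> T \<Longrightarrow> dist (du u w) p < e" for x T p e
    using limit_in_cball[OF rl(1)[unfolded du_right_limit_def] ntr[OF N(2)] that]
      limit_in_cball[OF rl(2)[unfolded du_left_limit_def] ntl[OF N(2)] that] by blast
  have lim_right: "(r \<longlongrightarrow> r y) (at_right y) \<and> (l \<longlongrightarrow> r y) (at_right y)" for y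
  proof -
    have "\<forall>\<^sub>F x in at_right y. dist (r x) (r y) < e \<and> dist (l x) (r y) < e" if e: "e > 0" for e
    proof -
      obtain \<rho> where \<rho>: "\<rho> > 0" "\<And>x. x \<in> diff_points u \<Longrightarrow> y < x \<Longrightarrow> x < y + \<rho> \<Longrightarrow> dist (du u x) (r y) < e / 2"
        using tendsto_at_right_within_dist[OF rl(1)[unfolded du_right_limit_def] half_gt_zero[OF e]] by blast
      have "dist (r x) (r y) \<le> e / 2 \<and> dist (l x) (r y) \<le> e / 2" if "y < x" "x < y + \<rho>" for x
        by (rule close[of "{y<..<y + \<rho>}"]) (use that \<rho> in auto)
      moreover have "e / 2 < e" using e by simp
      ultimately have "\<forall>x>y. x < y + \<rho> \<longrightarrow> dist (r x) (r y) < e \<and> dist (l x) (r y) < e" by (meson le_less_trans)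
      moreover have "y < y + \<rho>" using \<rho>(1) by simp
      ultimately show ?thesis unfolding eventually_at_right_field by blast
    qed
    then show ?thesis by (simp add: tendsto_iff eventually_conj_iff)
  qed
  have lim_left: "(r \<longlongrightarrow> l y) (at_left y) \<and> (l \<longlongrightarrow> l y) (at_left y)" for y
  proof -
    have "\<forall>\<^sub>F x in at_left y. dist (r x) (l y) < e \<and> dist (l x) (l y) < e" if e: "e > 0" for e
    proof -
      obtain \<rho> where \<rho>: "\<rho> > 0" "\<And>x. x \<in> diff_points u \<Longrightarrow> y - \<rho> < x \<Longrightarrow> x < y \<Longrightarrow> dist (du u x) (l y) < e / 2"
        using tendsto_at_left_within_dist[OF rl(2)[unfolded du_left_limit_def] half_gt_zero[OF e]] by blast
      have "dist (r x) (l y) \<le> e / 2 \<and> dist (l x) (l y) \<le> e / 2" if "y - \<rho> < x" "x < y" for x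
        by (rule close[of "{y - \<rho><..<y}"]) (use that \<rho> in auto)
      moreover have "e / 2 < e" using e by simp
      ultimately have "\<forall>x>y - \<rho>. x < y \<longrightarrow> dist (r x) (l y) < e \<and> dist (l x) (l y) < e" by (meson le_less_trans)
      moreover have "y - \<rho> < y" using \<rho>(1) by simp
      ultimately show ?thesis unfolding eventually_at_left_field by blast
    qed
    then show ?thesis by (simp add: tendsto_iff eventually_conj_iff)
  qed
  have jump: "l y = r y \<or> l y = - r y \<and> fst (r y) + snd (r y) \<le> 0" for y
  proof (cases "l y = r y")
    case False
    have neg: "l y = - r y"
      using \<Phi>_eq_imp[of "l y" "r y"] \<Phi>r[of y] \<Phi>l[of y] False by auto
    have "\<not> du_continuous_at u y"
    proof
      assume "du_continuous_at u y"
      then have "(du u \<longlongrightarrow> du u y) (at y within diff_points u)"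
        by (simp add: du_continuous_at_def continuous_within)
      then have "(du u \<longlongrightarrow> du u y) (at y within (diff_points u \<inter> {y<..}))"
        "(du u \<longlongrightarrow> du u y) (at y within (diff_points u \<inter> {..<y}))"
        by (auto intro: tendsto_within_subset)
      then have "du u y = r y" "du u y = l y"
        using tendsto_unique[OF ntr[OF N(2)] _ rl(1)[of y, unfolded du_right_limit_def]]
          tendsto_unique[OF ntl[OF N(2)] _ rl(2)[of y, unfolded du_left_limit_def]] by blast+
      then show False using False by simp
    qed
    \<comment> \<open>For \<open>l y = - r y\<close> both alternatives of admissibility say the
      same.\<close>
    then have "fst (r y) + snd (r y) \<le> 0" using adm'[of y] neg by auto
    then show ?thesis using neg by simp
  qed simp
  show ?thesis
    by (rule that[of r l]) (use right left \<Phi>r lim_right lim_left jump in blast)+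
qed

section \<open>Gluing the two half lines\<close>

text \<open>Sum and difference are the values of \<open>s\<close> and \<open>d\<close> at the
  equilibrium of the left half line. Reflection reverses the first sign, so both half lines have
  negative \<sigma> and \<delta>.\<close>

lemma sector_3_signs:
  assumes "(p, q) \<in> sector 3"
  shows "p + q > 0" "p - q < 0"
proof -
  obtain \<rho> \<theta> where *: "p = \<rho> * cos \<theta>" "q = \<rho> * sin \<theta>" "\<rho> > 0" "pi / 2 < \<theta>" "\<theta> < 3 * pi / 4"
    using assms by (auto simp: sector_def)
  have "sin (\<theta> + pi / 4) > 0" by (rule sin_gt_zero) (use * in auto)
  then have "sqrt 2 / 2 * (sin \<theta> + cos \<theta>) > 0" by (simp add: sin_add sin_45 cos_45 algebra_simps)
  then have "cos \<theta> + sin \<theta> > 0" by (simp add: zero_less_mult_iff)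
  then have "\<rho> * (cos \<theta> + sin \<theta>) > 0" using *(3) by simp
  then show "p + q > 0" by (simp add: * distrib_left)
  have "sin \<theta> > 0" by (rule sin_gt_zero) (use * pi_gt_zero in \<open>linarith+\<close>)
  moreover have "sin (\<theta> - pi / 2) > 0" by (rule sin_gt_zero) (use * pi_gt_zero in \<open>linarith+\<close>)
  ultimately have "cos \<theta> - sin \<theta> < 0" by (simp add: sin_diff)
  then have "\<rho> * (cos \<theta> - sin \<theta>) < 0" using *(3) by (simp add: mult_pos_neg)
  then show "p - q < 0" by (simp add: * right_diff_distrib)
qed

lemma sector_4_signs:
  assumes "(p, q) \<in> sector 4"
  shows "p + q < 0" "p - q < 0"
proof -
  obtain \<rho> \<theta> where *: "p = \<rho> * cos \<theta>" "q = \<rho> * sin \<theta>" "\<rho> > 0" "3 * pi / 4 < \<theta>" "\<theta> < pi"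
    using assms by (auto simp: sector_def)
  have "sin (\<theta> + pi / 4) < 0" by (rule sin_lt_zero) (use * pi_gt_zero in \<open>linarith+\<close>)
  then have "sqrt 2 / 2 * (sin \<theta> + cos \<theta>) < 0" by (simp add: sin_add sin_45 cos_45 algebra_simps)
  then have "cos \<theta> + sin \<theta> < 0" by (simp add: mult_less_0_iff)
  then have "\<rho> * (cos \<theta> + sin \<theta>) < 0" using *(3) by (simp add: mult_pos_neg)
  then show "p + q < 0" by (simp add: * distrib_left)
  have "sin \<theta> > 0" by (rule sin_gt_zero) (use * pi_gt_zero in \<open>linarith+\<close>)
  moreover have "sin (\<theta> - pi / 2) > 0" by (rule sin_gt_zero) (use * pi_gt_zero in \<open>linarith+\<close>)
  ultimately have "cos \<theta> - sin \<theta> < 0" by (simp add: sin_diff)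
  then have "\<rho> * (cos \<theta> - sin \<theta>) < 0" using *(3) by (simp add: mult_pos_neg)
  then show "p - q < 0" by (simp add: * right_diff_distrib)
qed

section \<open>Affine pieces and reflection\<close>

lemma affine_of_constant_derivative_right:
  fixes h :: "real \<Rightarrow> real"
  assumes "continuous_on UNIV h" "\<And>x. x > 0 \<Longrightarrow> (h has_real_derivative \<kappa>) (at x)" "x \<ge> 0"
  shows "h x = h 0 + \<kappa> * x"
proof (cases "x = 0")
  case False
  have "h x - \<kappa> * x = h 0 - \<kappa> * 0"
  proof (rule DERIV_isconst2[where f="\<lambda>x. h x - \<kappa> * x" and a=0 and b=x])
    show "continuous_on {0..x} (\<lambda>x. h x - \<kappa> * x)"
      by (intro continuous_intros continuous_on_subset[OF assms(1)]) auto
    show "((\<lambda>x. h x - \<kappa> * x) has_real_derivative 0) (at y)" if "0 < y" "y < x" for y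
      using DERIV_diff[OF assms(2)[OF that(1)] DERIV_cmult_Id[of \<kappa>]] by simp
  qed (use assms(3) False in auto)
  then show ?thesis by simp
qed simp

lemma affine_of_constant_derivative_left:
  fixes h :: "real \<Rightarrow> real"
  assumes "continuous_on UNIV h" "\<And>x. x < 0 \<Longrightarrow> (h has_real_derivative \<kappa>) (at x)" "x \<le> 0"
  shows "h x = h 0 + \<kappa> * x"
proof -
  have "h (- (- x)) = h (- 0) + (- \<kappa>) * (- x)"
  proof (rule affine_of_constant_derivative_right[where h="\<lambda>x. h (- x)"])
    show "continuous_on UNIV (\<lambda>x. h (- x))"
      by (rule continuous_on_compose2[OF assms(1)]) (auto intro: continuous_intros)
    show "((\<lambda>x. h (- x)) has_real_derivative - \<kappa>) (at y)" if "y > 0" for y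
      using DERIV_chain2[OF assms(2) DERIV_minus[OF DERIV_ident], of y] that by simp
  qed (use assms(3) in simp)
  then show ?thesis by simp
qed

lemma affine_right_derivative:
  fixes h :: "real \<Rightarrow> real"
  assumes "\<And>x. x \<ge> 0 \<Longrightarrow> h x = h 0 + \<kappa> * x" "x \<ge> 0"
  shows "(h has_real_derivative \<kappa>) (at_right x)"
  unfolding has_field_derivative_iff
proof (rule tendsto_eventually)
  have "(h y - h x) / (y - x) = \<kappa>" if "y > x" for y
  proof -
    have "h y - h x = \<kappa> * (y - x)"
      unfolding assms(1)[OF assms(2)] assms(1)[OF order_trans[OF assms(2) less_imp_le[OF that]]]
      by (simp add: algebra_simps)
    then show ?thesis using that by simp
  qed
  then show "\<forall>\<^sub>F y in at_right x. (h y - h x) / (y - x) = \<kappa>"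
    using eventually_at_right_less[of x] by (rule eventually_mono[rotated])
qed

lemma tendsto_reflect_right:
  fixes f :: "real \<Rightarrow> real"
  shows "(f \<longlongrightarrow> L) (at_left (- x)) \<Longrightarrow> ((\<lambda>y. f (- y)) \<longlongrightarrow> L) (at_right x)"
  by (simp add: at_left_minus filterlim_filtermap)

lemma tendsto_reflect_left:
  fixes f :: "real \<Rightarrow> real"
  shows "(f \<longlongrightarrow> L) (at_right (- x)) \<Longrightarrow> ((\<lambda>y. f (- y)) \<longlongrightarrow> L) (at_left x)"
  by (simp add: at_right_minus filterlim_filtermap)

lemma deriv_reflect_right:
  fixes f :: "real \<Rightarrow> real"
  assumes "(f has_real_derivative D) (at_left (- x))"
  shows "((\<lambda>y. f (- y)) has_real_derivative - D) (at_right x)"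
proof -
  have "((\<lambda>y. - ((f (- y) - f (- x)) / (- y - - x))) \<longlongrightarrow> - D) (at_right x)"
    using assms unfolding has_field_derivative_iff by (intro tendsto_minus tendsto_reflect_right) simp
  moreover have "- ((f (- y) - f (- x)) / (- y - - x)) = (f (- y) - f (- x)) / (y - x)" for y
  proof -
    have "- y - - x = - (y - x)" by simp
    then show ?thesis by (simp only: divide_minus_right minus_minus)
  qed
  ultimately show ?thesis unfolding has_field_derivative_iff by simp
qed

lemma deriv_reflect_left:
  fixes f :: "real \<Rightarrow> real"
  assumes "(f has_real_derivative D) (at_right (- x))"
  shows "((\<lambda>y. f (- y)) has_real_derivative - D) (at_left x)"
proof -
  have "((\<lambda>y. - ((f (- y) - f (- x)) / (- y - - x))) \<longlongrightarrow> - D) (at_left x)"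
    using assms unfolding has_field_derivative_iff by (intro tendsto_minus tendsto_reflect_left) simp
  moreover have "- ((f (- y) - f (- x)) / (- y - - x)) = (f (- y) - f (- x)) / (y - x)" for y
  proof -
    have "- y - - x = - (y - x)" by simp
    then show ?thesis by (simp only: divide_minus_right minus_minus)
  qed
  ultimately show ?thesis unfolding has_field_derivative_iff by simp
qed

lemma affine_left_derivative:
  fixes h :: "real \<Rightarrow> real"
  assumes "\<And>x. x \<le> 0 \<Longrightarrow> h x = h 0 + \<kappa> * x" "x \<le> 0"
  shows "(h has_real_derivative \<kappa>) (at_left x)"
proof -
  have "((\<lambda>y. h (- y)) has_real_derivative - \<kappa>) (at_right (- x))"
  proof (rule affine_right_derivative)
    show "h (- y) = h (- 0) + - \<kappa> * y" if "y \<ge> 0" for y using assms(1)[of "- y"] that by simp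
    show "- x \<ge> 0" using assms(2) by simp
  qed
  from deriv_reflect_left[OF this] show ?thesis by simp
qed

lemma vector_derivative_components:
  fixes u :: "real \<Rightarrow> real \<times> real"
  assumes "(u has_vector_derivative p) F"
  shows "((\<lambda>x. fst (u x)) has_real_derivative fst p) F" "((\<lambda>x. snd (u x)) has_real_derivative snd p) F"
  using bounded_linear.has_vector_derivative[OF bounded_linear_fst assms]
    bounded_linear.has_vector_derivative[OF bounded_linear_snd assms]
  by (simp_all add: has_real_derivative_iff_has_vector_derivative)

theorem mainTheorem4:
  fixes h1 h2 :: "real \<Rightarrow> real"
    and \<kappa>10 \<kappa>20 \<kappa>11 \<kappa>21 :: real
  assumes "continuous_on UNIV h1" and "continuous_on UNIV h2"
    and "\<And>x. x < 0 \<Longrightarrow> (h1 has_real_derivative \<kappa>10) (at x)"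
    and "\<And>x. x < 0 \<Longrightarrow> (h2 has_real_derivative \<kappa>20) (at x)"
    and "\<And>x. x > 0 \<Longrightarrow> (h1 has_real_derivative \<kappa>11) (at x)"
    and "\<And>x. x > 0 \<Longrightarrow> (h2 has_real_derivative \<kappa>21) (at x)"
    and "(\<kappa>10, \<kappa>20) \<in> sector 3"
    and "(\<kappa>11, \<kappa>21) \<in> sector 4"
  shows "\<not> (\<exists>u :: real \<Rightarrow> real \<times> real. admissible_solution h1 h2 u)"
proof
  assume "\<exists>u :: real \<Rightarrow> real \<times> real. admissible_solution h1 h2 u"
  then obtain u :: "real \<Rightarrow> real \<times> real" where adm: "admissible_solution h1 h2 u" by blast
  obtain r l :: "real \<Rightarrow> real \<times> real"
    where right: "\<And>y. (u has_vector_derivative r y) (at_right y)"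
      and left: "\<And>y. (u has_vector_derivative l y) (at_left y)"
      and \<Phi>: "\<And>y. fst (u y) = h1 y - \<Phi>1 (r y)" "\<And>y. snd (u y) = h2 y - \<Phi>2 (r y)"
      and lims: "\<And>y. (r \<longlongrightarrow> r y) (at_right y)" "\<And>y. (l \<longlongrightarrow> r y) (at_right y)"
        "\<And>y. (r \<longlongrightarrow> l y) (at_left y)" "\<And>y. (l \<longlongrightarrow> l y) (at_left y)"
      and jump: "\<And>y. l y = r y \<or> l y = - r y \<and> fst (r y) + snd (r y) \<le> 0"
    using admissible_one_sided[OF adm assms(1,2)] by metis
  obtain C where C: "\<And>x. norm (u x) \<le> C * (1 + \<bar>x\<bar>)" using adm by (auto simp: admissible_solution_def)
  have h1r: "h1 x = h1 0 + \<kappa>11 * x" if "x \<ge> 0" for x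
    using affine_of_constant_derivative_right[OF assms(1) assms(5) that] .
  have h2r: "h2 x = h2 0 + \<kappa>21 * x" if "x \<ge> 0" for x
    using affine_of_constant_derivative_right[OF assms(2) assms(6) that] .
  have h1l: "h1 x = h1 0 + \<kappa>10 * x" if "x \<le> 0" for x
    using affine_of_constant_derivative_left[OF assms(1) assms(3) that] .
  have h2l: "h2 x = h2 0 + \<kappa>20 * x" if "x \<le> 0" for x
    using affine_of_constant_derivative_left[OF assms(2) assms(4) that] .
  have h1r': "(h1 has_real_derivative \<kappa>11) (at_right x)" and h2r': "(h2 has_real_derivative \<kappa>21) (at_right x)"
    if "x \<ge> 0" for x
    using affine_right_derivative[of h1, OF h1r that] affine_right_derivative[of h2, OF h2r that] by auto
  have h1l': "(h1 has_real_derivative \<kappa>10) (at_left x)" and h2l': "(h2 has_real_derivative \<kappa>20) (at_left x)"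
    if x: "x \<le> 0" for x
    using affine_left_derivative[of h1, OF h1l x] affine_left_derivative[of h2, OF h2l x] by auto
  have u_cont: "continuous_on UNIV u"
  proof (rule continuous_at_imp_continuous_on, rule)
    fix x
    show "isCont u x"
      using has_vector_derivative_continuous[OF right[of x]] has_vector_derivative_continuous[OF left[of x]]
      by (simp add: isCont_def continuous_within filterlim_at_split)
  qed
  \<comment> \<open>Defined from \<open>h - u\<close>, hence continuous even where \<open>r\<close>
    jumps; the factors 2 and 4 normalise the quadratic map to \<open>s * d\<close> and
    \<open>3 * s\<^sup>2 - d\<^sup>2\<close>.\<close>
  define A where "A x = 2 * ((h1 x - fst (u x)) - (h2 x - snd (u x)))" for x
  define B where "B x = 4 * ((h1 x - fst (u x)) + (h2 x - snd (u x)))" for x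
  define s where "s x = fst (r x) + snd (r x)" for x
  define d where "d x = fst (r x) - snd (r x)" for x
  define sl where "sl x = fst (l x) + snd (l x)" for x
  define dl where "dl x = fst (l x) - snd (l x)" for x
  note defs = A_def B_def s_def d_def sl_def dl_def
  have contA: "continuous_on UNIV A" and contB: "continuous_on UNIV B"
    unfolding A_def B_def by (intro continuous_intros assms(1,2) u_cont)+
  have Aeq: "A x = s x * d x" and Beq: "B x = 3 * (s x)\<^sup>2 - (d x)\<^sup>2" for x
    unfolding defs \<Phi> \<Phi>1_def \<Phi>2_def by (simp_all add: power2_eq_square field_simps)
  have slims: "(s \<longlongrightarrow> s x) (at_right x)" "(d \<longlongrightarrow> d x) (at_right x)"
    "(sl \<longlongrightarrow> s x) (at_right x)" "(dl \<longlongrightarrow> d x) (at_right x)"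
    "(s \<longlongrightarrow> sl x) (at_left x)" "(d \<longlongrightarrow> dl x) (at_left x)"
    "(sl \<longlongrightarrow> sl x) (at_left x)" "(dl \<longlongrightarrow> dl x) (at_left x)" for x
    unfolding s_def d_def sl_def dl_def by (intro tendsto_intros lims)+
  have jumps: "sl x = s x \<and> dl x = d x \<or> sl x = - s x \<and> dl x = - d x \<and> s x \<le> 0" for x
  proof (cases "l x = r x")
    case True
    then show ?thesis by (simp only: s_def d_def sl_def dl_def simp_thms)
  next
    case False
    then have neg: "l x = - r x" "fst (r x) + snd (r x) \<le> 0" using jump[of x] by blast+
    have "sl x = - s x" "dl x = - d x" unfolding s_def d_def sl_def dl_def neg(1) by simp_all
    then show ?thesis using neg(2) by (simp add: s_def)
  qed
  have derivs: "(A has_real_derivative 2 * ((k1 - fst p) - (k2 - snd p))) (at y within S)"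
    "(B has_real_derivative 4 * ((k1 - fst p) + (k2 - snd p))) (at y within S)"
    if "(h1 has_real_derivative k1) (at y within S)" "(h2 has_real_derivative k2) (at y within S)" "(u has_vector_derivative p) (at y within S)" for k1 k2 p y S
  proof -
    note D = that(1,2) vector_derivative_components[OF that(3)]
    show "(A has_real_derivative 2 * ((k1 - fst p) - (k2 - snd p))) (at y within S)"
      unfolding A_def by (intro DERIV_cmult DERIV_diff D)
    show "(B has_real_derivative 4 * ((k1 - fst p) + (k2 - snd p))) (at y within S)"
      unfolding B_def by (intro DERIV_cmult DERIV_diff DERIV_add D)
  qed
  define K where "K = 8 * (\<bar>h1 0\<bar> + \<bar>h2 0\<bar> + \<bar>\<kappa>10\<bar> + \<bar>\<kappa>20\<bar> + \<bar>\<kappa>11\<bar> + \<bar>\<kappa>21\<bar> + C)"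
  have growth: "\<bar>A x\<bar> \<le> K * (1 + \<bar>x\<bar>)" "\<bar>B x\<bar> \<le> K * (1 + \<bar>x\<bar>)" for x
  proof -
    define S where "S = \<bar>h1 0\<bar> + \<bar>h2 0\<bar> + \<bar>\<kappa>10\<bar> + \<bar>\<kappa>20\<bar> + \<bar>\<kappa>11\<bar> + \<bar>\<kappa>21\<bar>"
    define M where "M = S * (1 + \<bar>x\<bar>)"
    have bound: "\<bar>c + k * x\<bar> \<le> M" if "\<bar>c\<bar> + \<bar>k\<bar> \<le> S" for c k
    proof -
      have "\<bar>c + k * x\<bar> \<le> \<bar>c\<bar> * 1 + \<bar>k\<bar> * \<bar>x\<bar>" using abs_triangle_ineq[of c "k * x"] by (simp add: abs_mult)
      also have "\<dots> \<le> \<bar>c\<bar> * (1 + \<bar>x\<bar>) + \<bar>k\<bar> * (1 + \<bar>x\<bar>)" by (intro add_mono mult_left_mono) auto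
      also have "\<dots> = (\<bar>c\<bar> + \<bar>k\<bar>) * (1 + \<bar>x\<bar>)" by (rule distrib_right[symmetric])
      also have "\<dots> \<le> M" unfolding M_def using that by (rule mult_right_mono) simp
      finally show ?thesis .
    qed
    have le: "\<bar>h1 0\<bar> + \<bar>\<kappa>11\<bar> \<le> S" "\<bar>h1 0\<bar> + \<bar>\<kappa>10\<bar> \<le> S" "\<bar>h2 0\<bar> + \<bar>\<kappa>21\<bar> \<le> S" "\<bar>h2 0\<bar> + \<bar>\<kappa>20\<bar> \<le> S"
      unfolding S_def by linarith+
    have "\<bar>h1 x\<bar> \<le> M \<and> \<bar>h2 x\<bar> \<le> M"
    proof (cases "x \<ge> 0")
      case True
      show ?thesis using bound[OF le(1)] bound[OF le(3)] by (simp only: h1r[OF True] h2r[OF True] simp_thms)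
    next
      case False
      then have "x \<le> 0" by simp
      then show ?thesis using bound[OF le(2)] bound[OF le(4)] by (simp only: h1l[OF \<open>x \<le> 0\<close>] h2l[OF \<open>x \<le> 0\<close>] simp_thms)
    qed
    moreover have "\<bar>fst (u x)\<bar> \<le> C * (1 + \<bar>x\<bar>)" "\<bar>snd (u x)\<bar> \<le> C * (1 + \<bar>x\<bar>)"
      using C[of x] norm_fst_le[of "fst (u x)" "snd (u x)"] norm_snd_le[of "snd (u x)" "fst (u x)"] by auto
    moreover have "K * (1 + \<bar>x\<bar>) = 8 * M + 8 * (C * (1 + \<bar>x\<bar>))"
      unfolding K_def S_def[symmetric] M_def by (simp only: distrib_left distrib_right mult.assoc)
    moreover have "\<bar>2 * ((a - f) - (b - g))\<bar> \<le> 8 * M + 8 * P \<and> \<bar>4 * ((a - f) + (b - g))\<bar> \<le> 8 * M + 8 * P"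
      if "\<bar>a\<bar> \<le> M \<and> \<bar>b\<bar> \<le> M" "\<bar>f\<bar> \<le> P" "\<bar>g\<bar> \<le> P" for a b f g P :: real
      using that by (auto simp: abs_le_iff)
    ultimately have "\<bar>A x\<bar> \<le> K * (1 + \<bar>x\<bar>) \<and> \<bar>B x\<bar> \<le> K * (1 + \<bar>x\<bar>)"
      unfolding A_def B_def by presburger
    then show "\<bar>A x\<bar> \<le> K * (1 + \<bar>x\<bar>)" "\<bar>B x\<bar> \<le> K * (1 + \<bar>x\<bar>)" by blast+
  qed
  interpret R: half_line_flow "\<kappa>11 + \<kappa>21" "\<kappa>11 - \<kappa>21" s d sl dl A B K
  proof
    show "\<kappa>11 + \<kappa>21 < 0" "\<kappa>11 - \<kappa>21 < 0" using sector_4_signs[OF assms(8)] by auto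
    show "continuous_on {0..} A" "continuous_on {0..} B"
      using contA contB by (auto intro: continuous_on_subset)
    fix x :: real
    show "A x = s x * d x" "B x = 3 * (s x)\<^sup>2 - (d x)\<^sup>2" by (rule Aeq, rule Beq)
    show "(A has_real_derivative 2 * (\<kappa>11 - \<kappa>21 - d x)) (at_right x)"
      "(B has_real_derivative 4 * (\<kappa>11 + \<kappa>21 - s x)) (at_right x)" if "0 \<le> x"
      using derivs[OF h1r'[OF that] h2r'[OF that] right] by (simp_all add: s_def d_def algebra_simps)
    show "(A has_real_derivative 2 * (\<kappa>11 - \<kappa>21 - dl x)) (at_left x)"
      "(B has_real_derivative 4 * (\<kappa>11 + \<kappa>21 - sl x)) (at_left x)" if "0 < x"
      using derivs[OF has_field_derivative_at_within[OF assms(5)[OF that]]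
          has_field_derivative_at_within[OF assms(6)[OF that]] left]
      by (simp_all add: sl_def dl_def algebra_simps)
    show "\<bar>A x\<bar> \<le> K * (1 + x)" "\<bar>B x\<bar> \<le> K * (1 + x)" if "0 \<le> x" using growth[of x] that by auto
    show "(s \<longlongrightarrow> s x) (at_right x)" "(d \<longlongrightarrow> d x) (at_right x)"
      "(s \<longlongrightarrow> sl x) (at_left x)" "(d \<longlongrightarrow> dl x) (at_left x)"
      by (fact slims)+
    show "sl x = s x \<and> dl x = d x \<or> sl x = - s x \<and> dl x = - d x \<and> s x \<le> 0" by (fact jumps)
  qed
  \<comment> \<open>the reflection \<open>x \<mapsto> - x\<close>, \<open>z \<mapsto> - cnj z\<close>, which exchanges left and right limits\<close>
  interpret L: half_line_flow "- (\<kappa>10 + \<kappa>20)" "\<kappa>10 - \<kappa>20" "\<lambda>x. - sl (- x)" "\<lambda>x. dl (- x)"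
    "\<lambda>x. - s (- x)" "\<lambda>x. d (- x)" "\<lambda>x. - A (- x)" "\<lambda>x. B (- x)" K
  proof
    show "- (\<kappa>10 + \<kappa>20) < 0" "\<kappa>10 - \<kappa>20 < 0" using sector_3_signs[OF assms(7)] by auto
    show "continuous_on {0..} (\<lambda>x. - A (- x))" "continuous_on {0..} (\<lambda>x. B (- x))"
      by (intro continuous_intros continuous_on_compose2[OF contA] continuous_on_compose2[OF contB]; simp)+
    fix x :: real
    \<comment> \<open>A jump only changes the sign of the pair, so \<open>A\<close> and
      \<open>B\<close> have the same expression in the left limits, which become the
      right-continuous functions after reflection.\<close>
    have "sl (- x) * dl (- x) = s (- x) * d (- x)" "(sl (- x))\<^sup>2 = (s (- x))\<^sup>2" "(dl (- x))\<^sup>2 = (d (- x))\<^sup>2"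
      using jumps[of "- x"] by auto
    then show "- A (- x) = - sl (- x) * dl (- x)" "B (- x) = 3 * (- sl (- x))\<^sup>2 - (dl (- x))\<^sup>2"
      using Aeq[of "- x"] Beq[of "- x"] by simp_all
    show "((\<lambda>x. - A (- x)) has_real_derivative 2 * (\<kappa>10 - \<kappa>20 - dl (- x))) (at_right x)"
      "((\<lambda>x. B (- x)) has_real_derivative 4 * (- (\<kappa>10 + \<kappa>20) - - sl (- x))) (at_right x)" if "0 \<le> x"
    proof -
      have "- x \<le> 0" using that by simp
      note D = derivs[OF h1l'[OF this] h2l'[OF this] left]
      show "((\<lambda>x. - A (- x)) has_real_derivative 2 * (\<kappa>10 - \<kappa>20 - dl (- x))) (at_right x)"
        using DERIV_minus[OF deriv_reflect_right[OF D(1)]] by (simp add: dl_def algebra_simps)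
      show "((\<lambda>x. B (- x)) has_real_derivative 4 * (- (\<kappa>10 + \<kappa>20) - - sl (- x))) (at_right x)"
        using deriv_reflect_right[OF D(2)] by (simp add: sl_def algebra_simps)
    qed
    show "((\<lambda>x. - A (- x)) has_real_derivative 2 * (\<kappa>10 - \<kappa>20 - d (- x))) (at_left x)"
      "((\<lambda>x. B (- x)) has_real_derivative 4 * (- (\<kappa>10 + \<kappa>20) - - s (- x))) (at_left x)" if "0 < x"
    proof -
      have "- x < 0" using that by simp
      note D = derivs[OF has_field_derivative_at_within[OF assms(3)[OF this]]
          has_field_derivative_at_within[OF assms(4)[OF this]] right]
      show "((\<lambda>x. - A (- x)) has_real_derivative 2 * (\<kappa>10 - \<kappa>20 - d (- x))) (at_left x)"
        using DERIV_minus[OF deriv_reflect_left[OF D(1)]] by (simp add: d_def algebra_simps)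
      show "((\<lambda>x. B (- x)) has_real_derivative 4 * (- (\<kappa>10 + \<kappa>20) - - s (- x))) (at_left x)"
        using deriv_reflect_left[OF D(2)] by (simp add: s_def algebra_simps)
    qed
    show "((\<lambda>x. - sl (- x)) \<longlongrightarrow> - sl (- x)) (at_right x)" "((\<lambda>x. dl (- x)) \<longlongrightarrow> dl (- x)) (at_right x)"
      by (intro tendsto_minus tendsto_reflect_right slims)+
    show "((\<lambda>x. - sl (- x)) \<longlongrightarrow> - s (- x)) (at_left x)" "((\<lambda>x. dl (- x)) \<longlongrightarrow> d (- x)) (at_left x)"
      by (intro tendsto_minus tendsto_reflect_left slims)+
    \<comment> \<open>Reversing time and the sign of \<open>s\<close> together keeps downward jumps
      downward: at a jump \<open>- sl (- x)\<close> equals \<open>s (- x) \<le> 0\<close>.\<close>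
    show "- s (- x) = - sl (- x) \<and> d (- x) = dl (- x) \<or>
        - s (- x) = - (- sl (- x)) \<and> d (- x) = - dl (- x) \<and> - sl (- x) \<le> 0"
      using jumps[of "- x"] by auto
    show "\<bar>- A (- x)\<bar> \<le> K * (1 + x)" "\<bar>B (- x)\<bar> \<le> K * (1 + x)" if "0 \<le> x"
      using growth[of "- x"] that by auto
  qed
  show False using R.A0_pos L.A0_pos by simp
qed

end
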